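(* Let $m\ge 0$ be an integer, $d\ge 4$ an even integer, and $n=m+d+1$. There exists a simple $d$-dimensional polar-to-neighborly polytope with exactly $n$ facets, labeled $1,\dots,n$, such that, identifying each vertex with the $d$-element set of labels of the facets containing it, the vertices are exactly the following sets: Type 1: the sets $$\{j_1,\,j_1+2\}\cup\{j_2,\,j_2+1\}\cup\cdots\cup\{j_{d/2},\,j_{d/2}+1\},$$ where $1\le j_1<n-d+1$, $j_1+3\le j_2$, $j_k+2\le j_{k+1}$ for $2\le k\le d/2-1$, and $j_{d/2}<n$. Type 2a: the sets $$\{j_1,\,j_1+1,\,j_1+2\}\cup\{j_2,\,j_2+1\}\cup\cdots\cup\{j_{d/2-1},\,j_{d/2-1}+1\}\cup\{n\}$$ (one triplet, $d/2-2$ pairs, and the singleton $\{n\}$), where $1\le j_1\le n-d+1$, $j_1+3\le j_2$ (if $d\ge 6$), $j_k+2\le j_{k+1}$ for $2\le k\le d/2-2$, and $j_{d/2-1}<n-1$. Type 2b: the sets $$\{1,2\}\cup\{j_1,\,j_1+1\}\cup\cdots\cup\{j_{d/2-1},\,j_{d/2-1}+1\},$$ where $3\le j_1$, $j_k+2\le j_{k+1}$ for $1\le k\le d/2-2$, and $j_{d/2-1}<n$.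
   Context: A $d$-dimensional polytope is simple if every vertex lies in exactly $d$ facets. A simple $d$-polytope is polar-to-neighborly if its polar is neighborly, i.e. any at most $\lfloor d/2\rfloor$ of its facets have nonempty common intersection. The combinatorial type of the polytope in the claim is denoted $\widetilde Q^d_m$ in the paper. *)

theory Defs
  imports "HOL-Analysis.Analysis"
begin

definition simple_polytope :: "nat \<Rightarrow> 'a::euclidean_space set \<Rightarrow> bool" where
  "simple_polytope d P \<longleftrightarrow>
     polytope P \<and> aff_dim P = int d \<and>
     (\<forall>v. v extreme_point_of P \<longrightarrow> card {G. G facet_of P \<and> v \<in> G} = d)"

(* Neighborliness of the polar, spelled out on the facets of P.  The empty family of facets
   is allowed; its intersection is taken inside P. *)
definition polar_to_neighborly :: "nat \<Rightarrow> 'a::euclidean_space set \<Rightarrow> bool" where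
  "polar_to_neighborly d P \<longleftrightarrow>
     simple_polytope d P \<and>
     (\<forall>S. S \<subseteq> {G. G facet_of P} \<and> finite S \<and> card S \<le> d div 2 \<longrightarrow> P \<inter> \<Inter>S \<noteq> {})"

(* The set of labels of the facets containing v, where F i is the facet labeled i. *)
definition facet_labels :: "nat \<Rightarrow> (nat \<Rightarrow> 'a set) \<Rightarrow> 'a \<Rightarrow> nat set" where
  "facet_labels n F v = {i \<in> {1..n}. v \<in> F i}"

(* In the three families below the indices are encoded by a function j on the naturals,
   of which only the values j 1, ..., j (d div 2), respectively j 1, ..., j (d div 2 - 1),
   matter.  They are meant for even d \<ge> 4 and n > d, so that no subtraction truncates to a
   wrong value. *)

definition type1 :: "nat \<Rightarrow> nat \<Rightarrow> nat set set" where
  "type1 n d =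
     {{j 1, j 1 + 2} \<union> (\<Union>k\<in>{2..d div 2}. {j k, j k + 1}) | j :: nat \<Rightarrow> nat.
        1 \<le> j 1 \<and> j 1 < n - d + 1 \<and> j 1 + 3 \<le> j 2 \<and>
        (\<forall>k. 2 \<le> k \<and> k \<le> d div 2 - 1 \<longrightarrow> j k + 2 \<le> j (k + 1)) \<and>
        j (d div 2) < n}"

definition type2a :: "nat \<Rightarrow> nat \<Rightarrow> nat set set" where
  "type2a n d =
     {{j 1, j 1 + 1, j 1 + 2} \<union> (\<Union>k\<in>{2..d div 2 - 1}. {j k, j k + 1}) \<union> {n} | j :: nat \<Rightarrow> nat.
        1 \<le> j 1 \<and> j 1 \<le> n - d + 1 \<and> (6 \<le> d \<longrightarrow> j 1 + 3 \<le> j 2) \<and>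
        (\<forall>k. 2 \<le> k \<and> k \<le> d div 2 - 2 \<longrightarrow> j k + 2 \<le> j (k + 1)) \<and>
        j (d div 2 - 1) < n - 1}"

definition type2b :: "nat \<Rightarrow> nat \<Rightarrow> nat set set" where
  "type2b n d =
     {{1, 2} \<union> (\<Union>k\<in>{1..d div 2 - 1}. {j k, j k + 1}) | j :: nat \<Rightarrow> nat.
        3 \<le> j 1 \<and>
        (\<forall>k. 1 \<le> k \<and> k \<le> d div 2 - 2 \<longrightarrow> j k + 2 \<le> j (k + 1)) \<and>
        j (d div 2 - 1) < n}"

end

theory Submission
  imports Defs
begin

text \<open>
  Pass to the polar: put \<open>n\<close> points \<open>q 1, \<dots>, q n\<close> in general position into \<open>d\<close>-space with
  their centroid at the origin, and let \<open>P\<close> be the set of all \<open>z\<close> with \<open>1 + z \<bullet> q i \<ge> 0\<close>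
  for all \<open>i\<close>. Then \<open>P\<close> is a polytope, and general position makes it simple. A set \<open>S\<close> of \<open>d\<close>
  labels is the label set of a vertex if and only if all points with labels outside \<open>S\<close> lie on
  one side of the hyperplane through the points with labels in \<open>S\<close>. So the combinatorial
  type of \<open>P\<close> can be read off from the sides on which the points lie.

  The points are given by a signed version of the moment curve: point \<open>i\<close> has the homogeneous
  coordinates \<open>(1, (-1)\<^sup>i t\<^sub>i, t\<^sub>i\<^sup>2, \<dots>, t\<^sub>i\<^sup>d)\<close>, where the \<open>t\<^sub>i\<close> grow rapidly. Rapid growth
  makes every maximal minor have the sign of its diagonal term, here given by the parity of its second
  smallest column (\<open>lex_signs_realizable\<close>, for arbitrary sign patterns). Without the
  sign \<open>(-1)\<^sup>i\<close> all these minors would be positive and \<open>P\<close> would be the polar of a cyclic polytope,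
  described by Gale's evenness condition. With it, the side of point \<open>x\<close> is the parity of the
  number of labels in \<open>S\<close> beyond \<open>x\<close> plus the second smallest label in \<open>insert x S\<close>.

  Let \<open>s < r\<close> be the two smallest labels in \<open>S\<close>. Labels between them lie on alternating sides,
  so that \<open>r \<le> s + 2\<close>. Beyond \<open>r\<close> the evenness condition, or its opposite, applies to the other
  labels in \<open>S\<close>. Comparing with the side of the labels before \<open>r\<close> leaves three cases
  (\<open>one_sided_iff\<close>), and these are the three types. Since any at most \<open>d div 2\<close> labels
  are contained in a set of one of these types (\<open>types_cover\<close>), the polytope is polar-to-neighborly.
\<close>

section \<open>Columns of rapid growth realize prescribed signs\<close>

text \<open>
  For a chain \<open>a\<^sub>0 < \<dots> < a\<^sub>k\<close> this is \<open>\<sigma> 0 a\<^sub>0 * \<dots> * \<sigma> k a\<^sub>k\<close>, the sign of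
  the diagonal term of the minor on the columns \<open>a\<^sub>0, \<dots>, a\<^sub>k\<close> of the matrix with
  entries \<open>\<sigma> j i * t i ^ j\<close>, when \<open>t\<close> is positive.
\<close>

definition lex_sign :: "(nat \<Rightarrow> nat \<Rightarrow> real) \<Rightarrow> nat set \<Rightarrow> real" where
  "lex_sign \<sigma> A = (\<Prod>a\<in>A. \<sigma> (card {b \<in> A. b < a}) a)"

text \<open>
  The value at column \<open>i\<close> of the linear functional with coefficients \<open>y 0, \<dots>, y k\<close> on
  the first \<open>k + 1\<close> rows of the matrix with entries \<open>\<sigma> j i * t i ^ j\<close>.
\<close>

definition signed_poly ::
  "(nat \<Rightarrow> nat \<Rightarrow> real) \<Rightarrow> (nat \<Rightarrow> real) \<Rightarrow> nat \<Rightarrow> (nat \<Rightarrow> real) \<Rightarrow> nat \<Rightarrow> real" where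
  "signed_poly \<sigma> t k y i = (\<Sum>j\<le>k. y j * \<sigma> j i * t i ^ j)"

text \<open>
  The condition says that all minors on an initial block of rows have the sign of their diagonal
  term, but avoids determinants. Up to a positive factor, the functional attached to \<open>S\<close> is
  \<open>x \<mapsto> det (columns of S, column x)\<close>: its leading coefficient is the minor of \<open>S\<close>, and
  moving the column \<open>x\<close> into its place costs one sign for each label of \<open>S\<close> beyond \<open>x\<close>.
  All sizes of \<open>S\<close> occur together because the induction on the number of columns passes from one
  size to the next.
\<close>

definition realizes_lex_signs ::
  "(nat \<Rightarrow> nat \<Rightarrow> real) \<Rightarrow> (nat \<Rightarrow> real) \<Rightarrow> nat \<Rightarrow> bool" where
  "realizes_lex_signs \<sigma> t N \<longleftrightarrow>
     (\<forall>S \<subseteq> {1..N}. \<exists>y. 0 < y (card S) * lex_sign \<sigma> S \<and>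
        (\<forall>i\<in>S. signed_poly \<sigma> t (card S) y i = 0) \<and>
        (\<forall>x\<in>{1..N} - S. 0 < signed_poly \<sigma> t (card S) y x *
            (-1) ^ card {s \<in> S. x < s} * lex_sign \<sigma> (insert x S)))"

lemma lex_sign_insert_greatest:
  assumes "finite A" "\<And>a. a \<in> A \<Longrightarrow> a < M"
  shows "lex_sign \<sigma> (insert M A) = \<sigma> (card A) M * lex_sign \<sigma> A"
proof -
  have M: "M \<notin> A" using assms(2) by blast
  have "{b \<in> insert M A. b < M} = A" using assms(2) by auto
  moreover have "(\<Prod>a\<in>A. \<sigma> (card {b \<in> insert M A. b < a}) a) = lex_sign \<sigma> A"
    unfolding lex_sign_def
  proof (rule prod.cong[OF refl])
    fix a assume "a \<in> A"
    then have "{b \<in> insert M A. b < a} = {b \<in> A. b < a}" using assms(2) by fastforce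
    then show "\<sigma> (card {b \<in> insert M A. b < a}) a = \<sigma> (card {b \<in> A. b < a}) a" by simp
  qed
  ultimately show ?thesis
    using assms(1) M by (simp add: lex_sign_def[of \<sigma> "insert M A"])
qed

lemma lex_sign_mult_self:
  assumes "\<And>k i. \<sigma> k i * \<sigma> k i = 1"
  shows "lex_sign \<sigma> A * lex_sign \<sigma> A = 1"
  unfolding lex_sign_def prod.distrib[symmetric] using assms by simp

lemma poly_over_leading_power_tendsto:
  fixes c :: "nat \<Rightarrow> real"
  shows "((\<lambda>\<tau>. (\<Sum>j\<le>k. c j * \<tau> ^ j) / \<tau> ^ k) \<longlongrightarrow> c k) at_top"
proof -
  have *: "((\<lambda>\<tau>. \<Sum>j\<le>k. c j * (\<tau> ^ j / \<tau> ^ k)) \<longlongrightarrow> (\<Sum>j\<le>k. c j * (if j = k then 1 else 0))) at_top"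
  proof (intro tendsto_sum tendsto_mult tendsto_const)
    fix j assume "j \<in> {..k}"
    show "((\<lambda>\<tau>::real. \<tau> ^ j / \<tau> ^ k) \<longlongrightarrow> (if j = k then 1 else 0)) at_top"
    proof (cases "j = k")
      case True
      have "\<forall>\<^sub>F \<tau>::real in at_top. \<tau> ^ j / \<tau> ^ k = 1"
        using eventually_gt_at_top[of 0] by eventually_elim (simp add: True)
      then show ?thesis using True by (simp add: tendsto_eventually)
    next
      case False
      with \<open>j \<in> {..k}\<close> have "j < k" by auto
      have "filterlim (\<lambda>\<tau>::real. \<tau> ^ (k - j)) at_infinity at_top"
        using \<open>j < k\<close>
        by (intro filterlim_at_top_imp_at_infinity filterlim_pow_at_top filterlim_ident) auto
      then have "((\<lambda>\<tau>::real. inverse (\<tau> ^ (k - j))) \<longlongrightarrow> 0) at_top"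
        by (rule tendsto_inverse_0[THEN filterlim_compose])
      moreover have "\<forall>\<^sub>F \<tau>::real in at_top. inverse (\<tau> ^ (k - j)) = \<tau> ^ j / \<tau> ^ k"
        using eventually_gt_at_top[of 0]
        by eventually_elim (use \<open>j < k\<close> in \<open>simp add: power_diff field_simps\<close>)
      ultimately show ?thesis using False by (auto intro: Lim_transform_eventually)
    qed
  qed
  have "(\<Sum>j\<le>k. c j * (if j = k then 1 else 0)) = c k"
    by (simp add: if_distrib cong: if_cong)
  then show ?thesis using * by (simp add: sum_divide_distrib)
qed

lemma eventually_leading_coeff_sign:
  fixes c :: "nat \<Rightarrow> real"
  assumes "0 < c k * e"
  shows "\<forall>\<^sub>F \<tau> in at_top. 0 < (\<Sum>j\<le>k. c j * \<tau> ^ j) * e"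
proof -
  have "((\<lambda>\<tau>. (\<Sum>j\<le>k. c j * \<tau> ^ j) / \<tau> ^ k * e) \<longlongrightarrow> c k * e) at_top"
    by (intro tendsto_mult poly_over_leading_power_tendsto tendsto_const)
  from order_tendstoD(1)[OF this assms] show ?thesis
    using eventually_gt_at_top[of 0]
    by eventually_elim (simp add: zero_less_mult_iff zero_less_divide_iff)
qed

lemma lower_degree_over_higher_tendsto_0:
  fixes b c :: "nat \<Rightarrow> real"
  assumes "b (Suc k) \<noteq> 0"
  shows "((\<lambda>\<tau>. (\<Sum>j\<le>k. c j * \<tau> ^ j) / (\<Sum>j\<le>Suc k. b j * \<tau> ^ j)) \<longlongrightarrow> 0) at_top"
proof -
  have "((\<lambda>\<tau>. ((\<Sum>j\<le>k. c j * \<tau> ^ j) / \<tau> ^ k) / ((\<Sum>j\<le>Suc k. b j * \<tau> ^ j) / \<tau> ^ Suc k)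
            * inverse \<tau>) \<longlongrightarrow> c k / b (Suc k) * 0) at_top"
    by (intro tendsto_mult tendsto_divide poly_over_leading_power_tendsto assms
          tendsto_inverse_0_at_top filterlim_ident)
  moreover have "\<forall>\<^sub>F \<tau> in at_top.
      ((\<Sum>j\<le>k. c j * \<tau> ^ j) / \<tau> ^ k) / ((\<Sum>j\<le>Suc k. b j * \<tau> ^ j) / \<tau> ^ Suc k) * inverse \<tau>
      = (\<Sum>j\<le>k. c j * \<tau> ^ j) / (\<Sum>j\<le>Suc k. b j * \<tau> ^ j)"
    using eventually_gt_at_top[of "0::real"]
    by eventually_elim (simp add: field_simps del: sum.atMost_Suc)
  ultimately show ?thesis by (auto intro: Lim_transform_eventually)
qed

lemma signed_poly_shift:
  assumes "k \<le> l"
  shows "signed_poly \<sigma> t l (\<lambda>j. if j \<le> k then y j else 0) i = signed_poly \<sigma> t k y i"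
proof -
  have "(\<Sum>j\<le>l. (if j \<le> k then y j else 0) * \<sigma> j i * t i ^ j)
      = (\<Sum>j\<in>{..l} \<inter> {j. j \<le> k}. y j * \<sigma> j i * t i ^ j)"
    by (simp add: sum.inter_restrict if_distrib if_distribR cong: if_cong)
  also have "{..l} \<inter> {j. j \<le> k} = {..k}" using assms by auto
  finally show ?thesis unfolding signed_poly_def .
qed

lemma signed_poly_linear:
  "signed_poly \<sigma> t k (\<lambda>j. a * y j + b * z j) i
     = a * signed_poly \<sigma> t k y i + b * signed_poly \<sigma> t k z i"
proof -
  have "(a * y j + b * z j) * \<sigma> j i * t i ^ j
      = a * (y j * \<sigma> j i * t i ^ j) + b * (z j * \<sigma> j i * t i ^ j)" for j
    by (simp add: algebra_simps)
  then show ?thesis by (simp add: signed_poly_def sum.distrib sum_distrib_left)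
qed

lemma signed_poly_sum:
  "signed_poly \<sigma> t k (\<lambda>j. \<Sum>s\<in>S. w s * y s j) i = (\<Sum>s\<in>S. w s * signed_poly \<sigma> t k (y s) i)"
proof -
  have "signed_poly \<sigma> t k (\<lambda>j. \<Sum>s\<in>S. w s * y s j) i
      = (\<Sum>j\<le>k. \<Sum>s\<in>S. w s * (y s j * \<sigma> j i * t i ^ j))"
    by (simp add: signed_poly_def sum_distrib_right mult.assoc)
  also have "\<dots> = (\<Sum>s\<in>S. \<Sum>j\<le>k. w s * (y s j * \<sigma> j i * t i ^ j))" by (rule sum.swap)
  finally show ?thesis by (simp add: signed_poly_def sum_distrib_left)
qed

lemma realizes_lex_signsE:
  assumes "realizes_lex_signs \<sigma> t N" "S \<subseteq> {1..N}"
  obtains y where "0 < y (card S) * lex_sign \<sigma> S"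
    and "\<And>i. i \<in> S \<Longrightarrow> signed_poly \<sigma> t (card S) y i = 0"
    and "\<And>x. x \<in> {1..N} - S \<Longrightarrow> 0 < signed_poly \<sigma> t (card S) y x *
            (-1) ^ card {s \<in> S. x < s} * lex_sign \<sigma> (insert x S)"
proof -
  from assms(1)[unfolded realizes_lex_signs_def, rule_format, OF assms(2)]
  show thesis by (elim exE conjE) (rule that; blast)
qed

text \<open>
  Subtract from the monomial of degree \<open>card S + 1\<close> its Lagrange interpolant on \<open>S\<close>; the
  functionals attached to the sets \<open>S - {s}\<close> serve as the Lagrange basis.
\<close>

lemma monic_signed_poly_vanishing:
  assumes R: "realizes_lex_signs \<sigma> t N" and S: "S \<subseteq> {1..N}"
  obtains h where "h (Suc (card S)) = 1" "\<And>i. i \<in> S \<Longrightarrow> signed_poly \<sigma> t (Suc (card S)) h i = 0"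
proof -
  have fin: "finite S" using S finite_subset by blast
  let ?k = "card S"
  have "\<forall>s\<in>S. \<exists>y. (\<forall>i\<in>S - {s}. signed_poly \<sigma> t (?k - 1) y i = 0) \<and>
                     signed_poly \<sigma> t (?k - 1) y s \<noteq> 0"
  proof
    fix s assume s: "s \<in> S"
    then have sub: "S - {s} \<subseteq> {1..N}" "s \<in> {1..N} - (S - {s})" and c: "card (S - {s}) = ?k - 1"
      using S fin by auto
    obtain y where "\<And>i. i \<in> S - {s} \<Longrightarrow> signed_poly \<sigma> t (?k - 1) y i = 0"
      and "0 < signed_poly \<sigma> t (?k - 1) y s *
            (-1) ^ card {a \<in> S - {s}. s < a} * lex_sign \<sigma> (insert s (S - {s}))"
      by (rule realizes_lex_signsE[OF R sub(1), unfolded c]) (rule that; (use sub(2) in blast))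
    then show "\<exists>y. (\<forall>i\<in>S - {s}. signed_poly \<sigma> t (?k - 1) y i = 0) \<and>
                     signed_poly \<sigma> t (?k - 1) y s \<noteq> 0"
      by (intro exI[of _ y]) auto
  qed
  then obtain y where y0: "\<And>s i. s \<in> S \<Longrightarrow> i \<in> S - {s} \<Longrightarrow> signed_poly \<sigma> t (?k - 1) (y s) i = 0"
    and y1: "\<And>s. s \<in> S \<Longrightarrow> signed_poly \<sigma> t (?k - 1) (y s) s \<noteq> 0"
    by metis
  let ?z = "\<lambda>s j. if j \<le> ?k - 1 then y s j else 0"
  have z: "signed_poly \<sigma> t (Suc ?k) (?z s) i = signed_poly \<sigma> t (?k - 1) (y s) i" for s i
    by (rule signed_poly_shift) simp
  let ?m = "\<lambda>j. if j = Suc ?k then 1 else 0"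
  let ?w = "\<lambda>s. signed_poly \<sigma> t (Suc ?k) ?m s / signed_poly \<sigma> t (?k - 1) (y s) s"
  let ?h = "\<lambda>j. 1 * ?m j + (-1) * (\<Sum>s\<in>S. ?w s * ?z s j)"
  have "?h (Suc ?k) = 1" by (auto intro!: sum.neutral)
  moreover have "signed_poly \<sigma> t (Suc ?k) ?h i = 0" if i: "i \<in> S" for i
  proof -
    have "signed_poly \<sigma> t (Suc ?k) (\<lambda>j. \<Sum>s\<in>S. ?w s * ?z s j) i
        = (\<Sum>s\<in>S. ?w s * signed_poly \<sigma> t (?k - 1) (y s) i)"
      unfolding signed_poly_sum z ..
    also have "\<dots> = (\<Sum>s\<in>{i}. ?w s * signed_poly \<sigma> t (?k - 1) (y s) i)"
      by (rule sum.mono_neutral_right) (use i fin y0 in auto)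
    also have "\<dots> = signed_poly \<sigma> t (Suc ?k) ?m i" using y1[OF i] by simp
    finally show ?thesis unfolding signed_poly_linear by simp
  qed
  ultimately show thesis by (rule that)
qed

text \<open>
  A new last column \<open>M\<close> with a huge parameter \<open>\<tau>\<close> keeps all the signs. If \<open>M\<close> is not in
  \<open>S\<close>, the old functional works, because at \<open>M\<close> its leading term dominates. If
  \<open>S = insert M A\<close>, take the functional \<open>p\<close> of \<open>A\<close> and one, \<open>h\<close>, of degree one more that
  also vanishes on \<open>A\<close>: the combination \<open>h - (H/P) p\<close>, where \<open>H\<close> and \<open>P\<close> are the values at
  \<open>M\<close>, vanishes on \<open>S\<close>. As \<open>P/H\<close> tends to 0, it has the signs of \<open>- (H/P) p\<close> on the old
  columns. Only finitely many sets \<open>S\<close> have to be served, hence a single \<open>\<tau>\<close> serves them all.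
\<close>

lemma realizes_lex_signs_extend:
  assumes \<sigma>: "\<And>k i. \<sigma> k i * \<sigma> k i = (1::real)" and R: "realizes_lex_signs \<sigma> t N"
  shows "\<exists>\<tau>. realizes_lex_signs \<sigma> (t(Suc N := \<tau>)) (Suc N)"
proof -
  define M where "M = Suc N"
  define good where "good S \<tau> \<longleftrightarrow> (\<exists>y. 0 < y (card S) * lex_sign \<sigma> S \<and>
        (\<forall>i\<in>S. signed_poly \<sigma> (t(M := \<tau>)) (card S) y i = 0) \<and>
        (\<forall>x\<in>{1..M} - S. 0 < signed_poly \<sigma> (t(M := \<tau>)) (card S) y x *
            (-1) ^ card {s \<in> S. x < s} * lex_sign \<sigma> (insert x S)))" for S \<tau>
  have below: "signed_poly \<sigma> (t(M := \<tau>)) k y i = signed_poly \<sigma> t k y i" if "i \<noteq> M" for \<tau> k y i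
    using that by (simp add: signed_poly_def)
  have at_M: "signed_poly \<sigma> (t(M := \<tau>)) k y M = (\<Sum>j\<le>k. (y j * \<sigma> j M) * \<tau> ^ j)" for \<tau> k y
    by (simp add: signed_poly_def)
  have "eventually (good S) at_top" if S: "S \<subseteq> {1..M}" for S
  proof -
    define A where "A = S - {M}"
    have A: "A \<subseteq> {1..N}" using S by (auto simp: A_def M_def)
    then have fin: "finite A" using finite_subset by blast
    have less: "a < M" if "a \<in> A" for a using A that by (auto simp: M_def)
    define k where "k = card A"
    obtain y where y: "0 < y k * lex_sign \<sigma> A"
      and y0: "\<And>i. i \<in> A \<Longrightarrow> signed_poly \<sigma> t k y i = 0"
      and yx: "\<And>x. x \<in> {1..N} - A \<Longrightarrow> 0 < signed_poly \<sigma> t k y x *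
            (-1) ^ card {s \<in> A. x < s} * lex_sign \<sigma> (insert x A)"
      by (rule realizes_lex_signsE[OF R A, folded k_def]) (rule that; blast)
    define P where "P \<tau> = (\<Sum>j\<le>k. (y j * \<sigma> j M) * \<tau> ^ j)" for \<tau>
    have insM: "lex_sign \<sigma> (insert M A) = \<sigma> k M * lex_sign \<sigma> A"
      unfolding k_def by (rule lex_sign_insert_greatest[OF fin less])
    have "y k * \<sigma> k M * (\<sigma> k M * lex_sign \<sigma> A) = y k * lex_sign \<sigma> A * (\<sigma> k M * \<sigma> k M)"
      by (simp only: ac_simps)
    also have "\<dots> = y k * lex_sign \<sigma> A" unfolding \<sigma> by simp
    finally have "0 < (y k * \<sigma> k M) * lex_sign \<sigma> (insert M A)" using y by (simp only: insM)
    then have evP: "\<forall>\<^sub>F \<tau> in at_top. 0 < P \<tau> * lex_sign \<sigma> (insert M A)"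
      unfolding P_def by (rule eventually_leading_coeff_sign)
    show ?thesis
    proof (cases "M \<in> S")
      case False
      then have SA: "S = A" by (auto simp: A_def)
      from evP show ?thesis
      proof eventually_elim
        case (elim \<tau>)
        have "0 < signed_poly \<sigma> (t(M := \<tau>)) k y x *
            (-1) ^ card {s \<in> A. x < s} * lex_sign \<sigma> (insert x A)" if x: "x \<in> {1..M} - A" for x
        proof (cases "x = M")
          case True
          have "{s \<in> A. M < s} = {}" using less by fastforce
          then show ?thesis unfolding True at_M using elim by (simp only: P_def card.empty power_0 mult_1_right)
        next
          case False
          then have "x \<in> {1..N} - A" using x by (auto simp: M_def)
          from yx[OF this] show ?thesis unfolding below[OF False] .
        qed
        moreover have "signed_poly \<sigma> (t(M := \<tau>)) k y i = 0" if "i \<in> A" for i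
          using y0[OF that] less[OF that] by (simp add: below)
        ultimately show ?case unfolding good_def SA using y k_def by blast
      qed
    next
      case True
      then have SA: "S = insert M A" by (auto simp: A_def)
      have MA: "M \<notin> A" by (simp add: A_def)
      have cS: "card S = Suc k" using fin MA by (simp add: SA k_def)
      obtain h where h: "h (Suc k) = 1" and h0: "\<And>i. i \<in> A \<Longrightarrow> signed_poly \<sigma> t (Suc k) h i = 0"
        using monic_signed_poly_vanishing[OF R A] unfolding k_def by blast
      define H where "H \<tau> = (\<Sum>j\<le>Suc k. (h j * \<sigma> j M) * \<tau> ^ j)" for \<tau>
      have "0 < (h (Suc k) * \<sigma> (Suc k) M) * \<sigma> (Suc k) M" using h \<sigma> by simp
      then have evH: "\<forall>\<^sub>F \<tau> in at_top. 0 < H \<tau> * \<sigma> (Suc k) M"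
        unfolding H_def by (rule eventually_leading_coeff_sign)
      have "\<sigma> (Suc k) M \<noteq> 0" using \<sigma>[of "Suc k" M] by auto
      then have lim: "((\<lambda>\<tau>. P \<tau> / H \<tau>) \<longlongrightarrow> 0) at_top"
        unfolding P_def H_def using h by (intro lower_degree_over_higher_tendsto_0) simp
      \<comment> \<open>The sign that the functional of \<open>A\<close> has at \<open>x\<close>; the strict inequality for it
        survives a small perturbation by \<open>h\<close>.\<close>
      define B where "B x = (-1) ^ card {s \<in> A. x < s} * lex_sign \<sigma> (insert x A)" for x
      have "\<forall>\<^sub>F \<tau> in at_top. 0 <
          (signed_poly \<sigma> t k y x - signed_poly \<sigma> t (Suc k) h x * (P \<tau> / H \<tau>)) * B x"
        if x: "x \<in> {1..N} - A" for x
      proof -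
        have "((\<lambda>\<tau>. (signed_poly \<sigma> t k y x - signed_poly \<sigma> t (Suc k) h x * (P \<tau> / H \<tau>)) * B x)
            \<longlongrightarrow> (signed_poly \<sigma> t k y x - signed_poly \<sigma> t (Suc k) h x * 0) * B x) at_top"
          by (intro tendsto_intros lim)
        from order_tendstoD(1)[OF this, of 0] show ?thesis
          using yx[OF x] by (simp add: B_def mult.assoc)
      qed
      then have "\<forall>\<^sub>F \<tau> in at_top. \<forall>x\<in>{1..N} - A. 0 <
          (signed_poly \<sigma> t k y x - signed_poly \<sigma> t (Suc k) h x * (P \<tau> / H \<tau>)) * B x"
        by (intro eventually_ball_finite) auto
      with evP evH show ?thesis
      proof eventually_elim
        case (elim \<tau>)
        define e where "e = lex_sign \<sigma> S"
        have e: "e * e = 1" unfolding e_def by (rule lex_sign_mult_self[OF \<sigma>])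
        have nz: "P \<tau> \<noteq> 0" "H \<tau> \<noteq> 0" using elim by auto
        \<comment> \<open>Up to the factor \<open>e\<close>, which corrects the sign of the leading coefficient, this is
          \<open>h - (H/P) y\<close>.\<close>
        define z where
          "z j = e * h j + (- e * (H \<tau> / P \<tau>)) * (if j \<le> k then y j else 0)" for j
        have ev: "signed_poly \<sigma> u (Suc k) z i
            = e * (signed_poly \<sigma> u (Suc k) h i - H \<tau> / P \<tau> * signed_poly \<sigma> u k y i)" for u i
          unfolding z_def signed_poly_linear signed_poly_shift[OF le_SucI[OF order_refl]]
          by (simp add: algebra_simps)
        have "z (Suc k) * e = 1" using h e by (simp add: z_def)
        moreover have "signed_poly \<sigma> (t(M := \<tau>)) (Suc k) z i = 0" if "i \<in> S" for i
        proof (cases "i = M")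
          case True
          then show ?thesis unfolding ev at_M True
            using nz unfolding P_def[symmetric] H_def[symmetric] by simp
        next
          case False
          then have "i \<in> A" using that SA by auto
          then show ?thesis unfolding below[OF False] ev using h0 y0 by simp
        qed
        moreover have "0 < signed_poly \<sigma> (t(M := \<tau>)) (Suc k) z x *
            (-1) ^ card {s \<in> S. x < s} * lex_sign \<sigma> (insert x S)" if x: "x \<in> {1..M} - S" for x
        proof -
          have xN: "x \<in> {1..N} - A" "x \<noteq> M" "x < M" using x by (auto simp: SA M_def)
          have "{s \<in> S. x < s} = insert M {s \<in> A. x < s}" using xN by (auto simp: SA)
          then have tail: "card {s \<in> S. x < s} = Suc (card {s \<in> A. x < s})"
            using fin MA by simp
          have "lex_sign \<sigma> (insert M (insert x A)) = \<sigma> (card (insert x A)) M * lex_sign \<sigma> (insert x A)"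
            by (rule lex_sign_insert_greatest) (use fin less xN in auto)
          then have ins: "lex_sign \<sigma> (insert x S) = \<sigma> (Suc k) M * lex_sign \<sigma> (insert x A)"
            using fin xN by (simp add: SA insert_commute k_def)
          have pos: "0 < (e * (P \<tau>)) * (\<sigma> (Suc k) M * H \<tau>)"
            using elim(1,2) by (simp add: e_def SA mult.commute)
          have "signed_poly \<sigma> (t(M := \<tau>)) (Suc k) z x * (-1) ^ card {s \<in> S. x < s} * lex_sign \<sigma> (insert x S)
            = (e * H \<tau> * \<sigma> (Suc k) M / P \<tau>) *
              ((signed_poly \<sigma> t k y x - signed_poly \<sigma> t (Suc k) h x * (P \<tau> / H \<tau>)) * B x)"
          proof -
            have *: "(a - b * (P \<tau> / H \<tau>)) * (H \<tau> / P \<tau>) = a * (H \<tau> / P \<tau>) - b" for a b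
              using nz by (simp add: field_simps)
            have **: "(e * H \<tau> * \<sigma> (Suc k) M / P \<tau>) * ((a - b * (P \<tau> / H \<tau>)) * c)
                = e * \<sigma> (Suc k) M * c * ((a - b * (P \<tau> / H \<tau>)) * (H \<tau> / P \<tau>))" for a b c
              by simp
            show ?thesis
              unfolding below[OF xN(2)] ev tail ins B_def ** * by (simp add: algebra_simps)
          qed
          moreover have "e * H \<tau> * \<sigma> (Suc k) M / P \<tau> = (e * (P \<tau>)) * (\<sigma> (Suc k) M * H \<tau>) / (P \<tau>)\<^sup>2"
            using nz by (simp add: power2_eq_square)
          moreover have "\<dots> > 0" using pos nz by simp
          moreover have "0 < (signed_poly \<sigma> t k y x
              - signed_poly \<sigma> t (Suc k) h x * (P \<tau> / H \<tau>)) * B x"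
            using elim(3) xN(1) by blast
          ultimately show ?thesis by (simp only: mult_pos_pos)
        qed
        ultimately show ?case unfolding good_def cS e_def by (intro exI[of _ z]) simp
      qed
    qed
  qed
  then have "\<forall>\<^sub>F \<tau> in at_top. \<forall>S\<in>Pow {1..M}. good S \<tau>"
    by (intro eventually_ball_finite) auto
  then obtain \<tau> where "\<forall>S\<in>Pow {1..M}. good S \<tau>"
    using eventually_happens'[OF trivial_limit_at_top_linorder] by blast
  then show ?thesis unfolding realizes_lex_signs_def good_def M_def by blast
qed

theorem lex_signs_realizable:
  assumes "\<And>k i. \<sigma> k i * \<sigma> k i = (1::real)"
  shows "\<exists>t. realizes_lex_signs \<sigma> t N"
proof (induction N)
  case 0
  then show ?case
    by (auto simp: realizes_lex_signs_def lex_sign_def intro!: exI[of _ "\<lambda>_. 1"])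
next
  case (Suc N)
  then show ?case using realizes_lex_signs_extend[of \<sigma>, OF assms] by blast
qed

section \<open>The polar of a configuration in general position\<close>

text \<open>
  Points in general position, given through affine functionals \<open>z \<mapsto> \<alpha> + a \<bullet> z\<close>: through
  any \<open>DIM('a)\<close> of the points there is a hyperplane that contains no other one. The centroid is
  placed at the origin, so that the polar is bounded.
\<close>

locale centred_general_configuration =
  fixes q :: "nat \<Rightarrow> 'a::euclidean_space" and n :: nat
  assumes centred: "(\<Sum>i\<in>{1..n}. q i) = 0"
    and more_than_dim: "DIM('a) < n"
    and separating: "\<And>S. S \<subseteq> {1..n} \<Longrightarrow> card S = DIM('a) \<Longrightarrow>
      \<exists>\<alpha> a. (\<forall>i\<in>S. \<alpha> + a \<bullet> q i = 0) \<and> (\<forall>i\<in>{1..n} - S. \<alpha> + a \<bullet> q i \<noteq> 0)"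
begin

text \<open>
  The polar of the convex hull of the points \<open>- q i\<close>.
\<close>

definition dual :: "'a set" where
  "dual = {z. \<forall>i\<in>{1..n}. 0 \<le> 1 + z \<bullet> q i}"

definition side :: "nat \<Rightarrow> 'a set" where
  "side i = {z \<in> dual. 1 + z \<bullet> q i = 0}"

definition tight :: "'a \<Rightarrow> nat set" where
  "tight z = {i \<in> {1..n}. 1 + z \<bullet> q i = 0}"

definition cofacet :: "nat set \<Rightarrow> bool" where
  "cofacet S \<longleftrightarrow> S \<subseteq> {1..n} \<and> card S = DIM('a) \<and>
     (\<exists>\<alpha> a. (\<forall>i\<in>S. \<alpha> + a \<bullet> q i = 0) \<and> (\<forall>i\<in>{1..n} - S. 0 < \<alpha> + a \<bullet> q i))"

text \<open>
  Each of the \<open>DIM('a) + 1\<close> lifted points \<open>(1, q i)\<close> is separated from the span of the others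
  by a functional, so they form a basis of the lifted space.
\<close>

lemma functional_eq_0:
  assumes T: "T \<subseteq> {1..n}" and c: "card T = Suc DIM('a)"
    and zero: "\<And>i. i \<in> T \<Longrightarrow> \<alpha> + a \<bullet> q i = 0"
  shows "\<alpha> = 0 \<and> a = 0"
proof -
  define v where "v i = (1::real, q i)" for i
  have fin: "finite T" using T finite_subset by blast
  have dual_basis: "\<exists>g. (\<forall>i\<in>T - {s}. g \<bullet> v i = 0) \<and> g \<bullet> v s \<noteq> 0" if s: "s \<in> T" for s
  proof -
    have "T - {s} \<subseteq> {1..n}" "card (T - {s}) = DIM('a)" "s \<in> {1..n} - (T - {s})"
      using T c s fin by auto
    then obtain \<beta> b where "\<forall>i\<in>T - {s}. \<beta> + b \<bullet> q i = 0" "\<beta> + b \<bullet> q s \<noteq> 0"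
      using separating[of "T - {s}"] by blast
    then show ?thesis by (intro exI[of _ "(\<beta>, b)"]) (simp add: v_def)
  qed
  have inj: "inj_on v T"
  proof (rule inj_onI)
    fix s r assume sr: "s \<in> T" "r \<in> T" "v s = v r"
    obtain g where "\<forall>i\<in>T - {s}. g \<bullet> v i = 0" "g \<bullet> v s \<noteq> 0" using dual_basis[OF sr(1)] by blast
    with sr show "s = r" by (cases "s = r") auto
  qed
  have ind: "independent (v ` T)"
    unfolding dependent_def
  proof (rule notI, elim bexE imageE)
    fix y s assume s: "s \<in> T" and "y \<in> span (v ` T - {y})" and "y = v s"
    then have sp: "v s \<in> span (v ` T - {v s})" by simp
    obtain g where g: "\<forall>i\<in>T - {s}. g \<bullet> v i = 0" "g \<bullet> v s \<noteq> 0" using dual_basis[OF s] by blast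
    have "orthogonal g (v s)"
      by (rule orthogonal_to_span[OF sp]) (use g(1) in \<open>auto simp: orthogonal_def\<close>)
    then show False using g(2) by (simp add: orthogonal_def)
  qed
  have "dim (UNIV :: (real \<times> 'a) set) \<le> card (v ` T)"
    using c card_image[OF inj] by simp
  then have "UNIV \<subseteq> span (v ` T)"
    by (intro card_ge_dim_independent ind) auto
  then have "(\<alpha>, a) \<in> span (v ` T)" by blast
  then have "orthogonal (\<alpha>, a) (\<alpha>, a)"
    by (rule orthogonal_to_span) (use zero in \<open>auto simp: orthogonal_def v_def\<close>)
  then have "(\<alpha>, a) = 0" unfolding orthogonal_def inner_eq_zero_iff .
  then show ?thesis by (simp add: zero_prod_def)
qed

text \<open>
  A hyperplane through \<open>DIM('a)\<close> of the points determines its functional up to a factor: choose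
  the factor so that the difference also vanishes at one further point.
\<close>

lemma functional_proportional:
  assumes S: "S \<subseteq> {1..n}" "card S = DIM('a)"
    and f: "\<And>i. i \<in> S \<Longrightarrow> \<alpha> + a \<bullet> q i = 0"
    and g: "\<And>i. i \<in> S \<Longrightarrow> \<beta> + b \<bullet> q i = 0" "\<beta> \<noteq> 0 \<or> b \<noteq> 0"
  obtains c where "\<alpha> = c * \<beta>" "a = c *\<^sub>R b"
proof -
  have fin: "finite S" using S finite_subset by blast
  have "\<not> {1..n} \<subseteq> S" using S more_than_dim card_mono[OF fin, of "{1..n}"] by auto
  then obtain x where x: "x \<in> {1..n}" "x \<notin> S" by blast
  have T: "insert x S \<subseteq> {1..n}" "card (insert x S) = Suc DIM('a)"
    using S x fin by auto
  have gx: "\<beta> + b \<bullet> q x \<noteq> 0"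
    using functional_eq_0[OF T, of \<beta> b] g by auto
  define c where "c = (\<alpha> + a \<bullet> q x) / (\<beta> + b \<bullet> q x)"
  have "(\<alpha> - c * \<beta>) + (a - c *\<^sub>R b) \<bullet> q i = 0" if "i \<in> insert x S" for i
  proof -
    have "(\<alpha> - c * \<beta>) + (a - c *\<^sub>R b) \<bullet> q i = (\<alpha> + a \<bullet> q i) - c * (\<beta> + b \<bullet> q i)"
      by (simp add: inner_diff_left algebra_simps)
    also have "\<dots> = 0"
    proof (cases "i = x")
      case True
      then show ?thesis using gx by (simp add: c_def)
    next
      case False
      then have "i \<in> S" using that by simp
      then show ?thesis by (simp add: f g(1))
    qed
    finally show ?thesis .
  qed
  from functional_eq_0[OF T this] that[of c] show thesis by simp
qed

lemma finite_tight: "finite (tight z)" and tight_subset: "tight z \<subseteq> {1..n}"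
  by (auto simp: tight_def)

lemma card_tight_le: "card (tight z) \<le> DIM('a)"
proof (rule ccontr)
  assume "\<not> ?thesis"
  then have "Suc DIM('a) \<le> card (tight z)" by simp
  then obtain T where T: "T \<subseteq> tight z" "card T = Suc DIM('a)"
    by (rule obtain_subset_with_card_n)
  then have "(1::real) = 0 \<and> z = 0"
    by (intro functional_eq_0[of T]) (auto simp: tight_def)
  then show False by simp
qed

text \<open>
  Both \<open>z\<close> and \<open>w\<close> stand for functionals with constant term 1, so the factor between them is 1.
\<close>

lemma tight_subset_imp_eq:
  assumes "card (tight z) = DIM('a)" "tight z \<subseteq> tight w"
  shows "w = z"
proof -
  have "1 + w \<bullet> q i = 0" "1 + z \<bullet> q i = 0" if "i \<in> tight z" for i
    using that assms(2) by (auto simp: tight_def)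
  then obtain c where "1 = c * (1::real)" "w = c *\<^sub>R z"
    by (rule functional_proportional[OF tight_subset assms(1)]) auto
  then show ?thesis by simp
qed

lemma slack_move: "1 + (z + s *\<^sub>R u) \<bullet> q j = (1 + z \<bullet> q j) + s * (u \<bullet> q j)"
  by (simp add: inner_add_left)

lemma small_move:
  assumes z: "z \<in> dual"
  obtains \<epsilon> where "0 < \<epsilon>" "\<And>j. j \<in> {1..n} - tight z \<Longrightarrow> \<epsilon> * \<bar>u \<bullet> q j\<bar> < 1 + z \<bullet> q j"
proof -
  have "\<forall>\<^sub>F \<epsilon> in at_right 0. \<epsilon> * \<bar>u \<bullet> q j\<bar> < 1 + z \<bullet> q j" if "j \<in> {1..n} - tight z" for j
  proof -
    have "0 < 1 + z \<bullet> q j" using that z by (force simp: dual_def tight_def)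
    moreover have "((\<lambda>\<epsilon>. \<epsilon> * \<bar>u \<bullet> q j\<bar>) \<longlongrightarrow> 0 * \<bar>u \<bullet> q j\<bar>) (at_right 0)"
      by (intro tendsto_intros)
    ultimately show ?thesis by (intro order_tendstoD(2)) auto
  qed
  then have "\<forall>\<^sub>F \<epsilon> in at_right 0. \<forall>j\<in>{1..n} - tight z. \<epsilon> * \<bar>u \<bullet> q j\<bar> < 1 + z \<bullet> q j"
    by (intro eventually_ball_finite) auto
  with eventually_at_right_less[of "0::real"]
  have "\<forall>\<^sub>F \<epsilon> in at_right 0. 0 < \<epsilon> \<and> (\<forall>j\<in>{1..n} - tight z. \<epsilon> * \<bar>u \<bullet> q j\<bar> < 1 + z \<bullet> q j)"
    by eventually_elim auto
  from eventually_happens'[OF _ this] obtain \<epsilon> where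
    "0 < \<epsilon> \<and> (\<forall>j\<in>{1..n} - tight z. \<epsilon> * \<bar>u \<bullet> q j\<bar> < 1 + z \<bullet> q j)"
    by auto
  then show thesis by (intro that) auto
qed

lemma orthogonal_to_few:
  assumes "finite J" "card J < DIM('a)"
  obtains u where "u \<noteq> 0" "\<And>j. j \<in> J \<Longrightarrow> u \<bullet> q j = 0"
proof -
  have "dim (span (q ` J)) \<le> card (q ` J)" using assms(1) by (simp add: dim_le_card')
  also have "\<dots> < DIM('a)" using assms card_image_le[of J q] by simp
  finally obtain u where u: "u \<noteq> 0" "\<And>y. y \<in> span (q ` J) \<Longrightarrow> orthogonal u y"
    using orthogonal_to_subspace_exists[of "q ` J"] by auto
  show thesis
  proof (rule that[OF u(1)])
    fix j assume "j \<in> J"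
    then show "u \<bullet> q j = 0" using u(2)[OF span_base, of "q j"] by (simp add: orthogonal_def)
  qed
qed

text \<open>
  At a vertex \<open>z\<close> of the polar this is the direction of the edge that leaves side \<open>i\<close> and stays
  in the other sides through \<open>z\<close>.
\<close>

lemma edge_direction:
  assumes "card (tight z) = DIM('a)" "i \<in> tight z"
  obtains u where "u \<bullet> q i = 1" "\<And>k. k \<in> tight z \<Longrightarrow> k \<noteq> i \<Longrightarrow> u \<bullet> q k = 0"
proof -
  have "card (tight z - {i}) < DIM('a)"
    using assms finite_tight by (metis card_Diff1_less)
  then obtain u where u: "u \<noteq> 0" "\<And>j. j \<in> tight z - {i} \<Longrightarrow> u \<bullet> q j = 0"
    by (rule orthogonal_to_few[OF finite_Diff[OF finite_tight]]) (rule that; blast)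
  have "u \<bullet> q i \<noteq> 0"
  proof
    assume "u \<bullet> q i = 0"
    then have "tight z \<subseteq> tight (z + u)" using u(2) by (force simp: tight_def inner_add_left)
    from tight_subset_imp_eq[OF assms(1) this] u(1) show False by simp
  qed
  then show thesis by (intro that[of "u /\<^sub>R (u \<bullet> q i)"]) (auto simp: u(2))
qed

text \<open>
  With fewer than \<open>DIM('a)\<close> tight inequalities some line through \<open>z\<close> stays in the polar for a
  while in both directions. With \<open>DIM('a)\<close> of them, the ends of a segment around \<open>z\<close> are tight
  wherever \<open>z\<close> is, and these equations have only one solution.
\<close>

lemma extreme_point_of_dual_iff:
  "z extreme_point_of dual \<longleftrightarrow> z \<in> dual \<and> card (tight z) = DIM('a)"
proof
  assume z: "z extreme_point_of dual"
  then have zd: "z \<in> dual" by (simp add: extreme_point_of_def)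
  have "\<not> card (tight z) < DIM('a)"
  proof
    assume "card (tight z) < DIM('a)"
    then obtain u where u: "u \<noteq> 0" "\<And>j. j \<in> tight z \<Longrightarrow> u \<bullet> q j = 0"
      by (rule orthogonal_to_few[OF finite_tight]) (rule that; blast)
    obtain \<epsilon> where \<epsilon>: "0 < \<epsilon>" "\<And>j. j \<in> {1..n} - tight z \<Longrightarrow> \<epsilon> * \<bar>u \<bullet> q j\<bar> < 1 + z \<bullet> q j"
      by (rule small_move[OF zd, where u = u]) (rule that; blast)
    have mv: "z + s *\<^sub>R u \<in> dual" if "\<bar>s\<bar> = \<epsilon>" for s
      unfolding dual_def mem_Collect_eq
    proof
      fix j assume j: "j \<in> {1..n}"
      show "0 \<le> 1 + (z + s *\<^sub>R u) \<bullet> q j"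
      proof (cases "j \<in> tight z")
        case True
        then show ?thesis unfolding slack_move u(2)[OF True] by (simp add: tight_def)
      next
        case False
        have "\<bar>s * (u \<bullet> q j)\<bar> < 1 + z \<bullet> q j" using \<epsilon>(2)[of j] False j that by (simp add: abs_mult)
        then show ?thesis unfolding slack_move by linarith
      qed
    qed
    let ?a = "z + \<epsilon> *\<^sub>R u" and ?b = "z + (- \<epsilon>) *\<^sub>R u"
    have "?a \<noteq> ?b"
    proof
      assume "?a = ?b"
      then have "\<epsilon> *\<^sub>R u + \<epsilon> *\<^sub>R u = 0" by (simp add: eq_neg_iff_add_eq_0)
      then have "2 *\<^sub>R (\<epsilon> *\<^sub>R u) = 0" unfolding scaleR_2 .
      then show False using u(1) \<epsilon>(1) by simp
    qed
    moreover have mid: "midpoint ?a ?b = z" by (simp add: midpoint_eq_iff)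
    ultimately have "z \<in> open_segment ?a ?b"
      using midpoint_in_open_segment[of ?a ?b] unfolding mid by blast
    with z mv[of \<epsilon>] mv[of "- \<epsilon>"] \<epsilon>(1) show False by (auto simp: extreme_point_of_def)
  qed
  with zd card_tight_le[of z] show "z \<in> dual \<and> card (tight z) = DIM('a)" by simp
next
  assume z: "z \<in> dual \<and> card (tight z) = DIM('a)"
  show "z extreme_point_of dual"
    unfolding extreme_point_of_def
  proof (intro conjI ballI notI)
    show "z \<in> dual" using z by simp
    fix a b assume a: "a \<in> dual" and b: "b \<in> dual" and "z \<in> open_segment a b"
    then obtain t where ab: "a \<noteq> b" and t: "0 < t" "t < 1" "z = (1 - t) *\<^sub>R a + t *\<^sub>R b"
      by (auto simp: in_segment)
    have *: "1 + a \<bullet> q i = 0 \<and> 1 + b \<bullet> q i = 0" if "i \<in> tight z" for i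
    proof -
      have nn: "0 \<le> 1 + a \<bullet> q i" "0 \<le> 1 + b \<bullet> q i" using a b that by (auto simp: dual_def tight_def)
      have "(1 - t) * (1 + a \<bullet> q i) + t * (1 + b \<bullet> q i) = 1 + z \<bullet> q i"
        by (simp add: t(3) inner_add_left algebra_simps)
      also have "\<dots> = 0" using that by (simp add: tight_def)
      finally have "(1 - t) * (1 + a \<bullet> q i) = 0 \<and> t * (1 + b \<bullet> q i) = 0"
        using nn t by (subst (asm) add_nonneg_eq_0_iff) auto
      then show ?thesis using t by simp
    qed
    then have "tight z \<subseteq> tight a" "tight z \<subseteq> tight b" by (auto simp: tight_def)
    then have "a = z" "b = z" using z tight_subset_imp_eq by blast+
    with ab show False by simp
  qed
qed

text \<open>
  The constant term \<open>\<alpha>\<close> of a functional that is positive off \<open>S\<close> is positive, because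
  \<open>n * \<alpha>\<close> is the sum of its values on the centred points. Dividing by it gives a point of the
  polar.
\<close>

lemma vertex_of_cofacet:
  assumes "cofacet S"
  obtains z where "z extreme_point_of dual" "tight z = S"
proof -
  from assms obtain \<alpha> a where S: "S \<subseteq> {1..n}" "card S = DIM('a)"
    and zero: "\<And>i. i \<in> S \<Longrightarrow> \<alpha> + a \<bullet> q i = 0"
    and pos: "\<And>i. i \<in> {1..n} - S \<Longrightarrow> 0 < \<alpha> + a \<bullet> q i"
    unfolding cofacet_def by blast
  have fin: "finite S" using S finite_subset by blast
  have "\<not> {1..n} \<subseteq> S" using S more_than_dim card_mono[OF fin, of "{1..n}"] by auto
  then obtain x where x: "x \<in> {1..n} - S" by blast
  have "0 < (\<Sum>i\<in>{1..n}. \<alpha> + a \<bullet> q i)"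
  proof (rule sum_pos2[of _ x])
    fix i assume "i \<in> {1..n}"
    then show "0 \<le> \<alpha> + a \<bullet> q i" using zero pos by (cases "i \<in> S") (auto simp: less_imp_le)
  qed (use x pos in auto)
  also have "\<dots> = n * \<alpha>"
    using centred by (simp add: sum.distrib flip: inner_sum_right)
  finally have \<alpha>: "0 < \<alpha>" by (simp add: zero_less_mult_iff)
  define z where "z = a /\<^sub>R \<alpha>"
  have slack: "1 + z \<bullet> q i = (\<alpha> + a \<bullet> q i) / \<alpha>" for i
    using \<alpha> by (simp add: z_def field_simps)
  have "tight z = S" unfolding tight_def slack using S zero pos \<alpha> by force
  moreover have "z \<in> dual"
    unfolding dual_def slack mem_Collect_eq
  proof
    fix i assume "i \<in> {1..n}"
    then show "0 \<le> (\<alpha> + a \<bullet> q i) / \<alpha>"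
      using zero[of i] pos[of i] \<alpha> by (cases "i \<in> S") auto
  qed
  ultimately show thesis using S(2) by (intro that) (auto simp: extreme_point_of_dual_iff)
qed

lemma cofacet_tight:
  assumes "z extreme_point_of dual"
  shows "cofacet (tight z)"
proof -
  have z: "z \<in> dual" "card (tight z) = DIM('a)" using assms extreme_point_of_dual_iff by auto
  have "0 < 1 + z \<bullet> q i" if "i \<in> {1..n} - tight z" for i
    using that z(1) by (force simp: dual_def tight_def)
  moreover have "1 + z \<bullet> q i = 0" if "i \<in> tight z" for i
    using that by (simp add: tight_def)
  ultimately show ?thesis unfolding cofacet_def using tight_subset z(2) by blast
qed

lemma bij_betw_tight: "bij_betw tight {z. z extreme_point_of dual} {S. cofacet S}"
proof (rule bij_betwI')
  fix z w assume "z \<in> {z. z extreme_point_of dual}" "w \<in> {z. z extreme_point_of dual}"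
  then show "tight z = tight w \<longleftrightarrow> z = w"
    using tight_subset_imp_eq[of z w] by (auto simp: extreme_point_of_dual_iff)
next
  fix S assume "S \<in> {S. cofacet S}"
  then obtain z where "z extreme_point_of dual" "tight z = S"
    using vertex_of_cofacet[of S] by auto
  then show "\<exists>z\<in>{z. z extreme_point_of dual}. S = tight z" by auto
qed (use cofacet_tight in auto)

lemma polyhedron_dual: "polyhedron dual"
proof -
  have "0 \<le> 1 + z \<bullet> q i \<longleftrightarrow> z \<in> {z. (- q i) \<bullet> z \<le> 1}" for z i
    by (auto simp: inner_commute)
  then have eq: "dual = \<Inter>((\<lambda>i. {z. (- q i) \<bullet> z \<le> 1}) ` {1..n})"
    unfolding dual_def by blast
  show ?thesis
    unfolding eq
  proof (rule polyhedron_Inter)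
    fix H assume "H \<in> (\<lambda>i. {z. (- q i) \<bullet> z \<le> 1}) ` {1..n}"
    then obtain i where "H = {z. (- q i) \<bullet> z \<le> 1}" by blast
    then show "polyhedron H" by (simp only: polyhedron_halfspace_le)
  qed simp
qed

lemma span_configuration: "span (q ` {1..n}) = UNIV"
proof (rule ccontr)
  assume "span (q ` {1..n}) \<noteq> UNIV"
  then have "dim (q ` {1..n}) \<noteq> DIM('a)" by (simp only: dim_eq_full not_False_eq_True)
  then have "dim (q ` {1..n}) < DIM('a)"
    using dim_subset_UNIV[of "q ` {1..n}"] by simp
  then obtain u where u: "u \<noteq> 0" "\<And>y. y \<in> span (q ` {1..n}) \<Longrightarrow> orthogonal u y"
    by (rule orthogonal_to_subspace_exists) (rule that; blast)
  have "(0::real) = 0 \<and> u = 0"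
  proof (rule functional_eq_0[of "{1..Suc DIM('a)}"])
    fix i assume "i \<in> {1..Suc DIM('a)}"
    then have "q i \<in> span (q ` {1..n})" using more_than_dim by (intro span_base) auto
    then show "0 + u \<bullet> q i = 0" using u(2) by (simp add: orthogonal_def)
  qed (use more_than_dim in auto)
  with u(1) show False by simp
qed

text \<open>
  On the polar the \<open>n\<close> nonnegative numbers \<open>1 + z \<bullet> q i\<close> have sum \<open>n\<close>. Hence all
  \<open>z \<bullet> q i\<close> are bounded, and the points \<open>q i\<close> span the space.
\<close>

lemma bounded_dual: "bounded dual"
proof -
  \<comment> \<open>The directions in which the polar is bounded form a subspace.\<close>
  define V where "V = {b. \<exists>K. \<forall>z\<in>dual. \<bar>z \<bullet> b\<bar> \<le> K}"
  have "subspace V"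
    unfolding subspace_def
  proof (intro conjI ballI allI)
    show "0 \<in> V" by (auto simp: V_def)
    fix x y assume "x \<in> V" "y \<in> V"
    then obtain K L where "\<forall>z\<in>dual. \<bar>z \<bullet> x\<bar> \<le> K" "\<forall>z\<in>dual. \<bar>z \<bullet> y\<bar> \<le> L" by (auto simp: V_def)
    then have "\<forall>z\<in>dual. \<bar>z \<bullet> (x + y)\<bar> \<le> K + L" by (force simp: inner_add_right)
    then show "x + y \<in> V" by (auto simp: V_def)
  next
    fix c :: real and x assume "x \<in> V"
    then obtain K where "\<forall>z\<in>dual. \<bar>z \<bullet> x\<bar> \<le> K" by (auto simp: V_def)
    then have "\<forall>z\<in>dual. \<bar>z \<bullet> (c *\<^sub>R x)\<bar> \<le> \<bar>c\<bar> * K" by (auto simp: abs_mult mult_left_mono)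
    then show "c *\<^sub>R x \<in> V" by (auto simp: V_def)
  qed
  moreover have "q ` {1..n} \<subseteq> V"
  proof clarify
    fix i assume i: "i \<in> {1..n}"
    have "\<bar>z \<bullet> q i\<bar> \<le> 1 + real n" if z: "z \<in> dual" for z
    proof -
      have "1 + z \<bullet> q i \<le> (\<Sum>j\<in>{1..n}. 1 + z \<bullet> q j)"
        using i z by (intro member_le_sum) (auto simp: dual_def)
      also have "\<dots> = n" using centred by (simp add: sum.distrib flip: inner_sum_right)
      finally show ?thesis using z i by (force simp: dual_def)
    qed
    then show "q i \<in> V" by (auto simp: V_def)
  qed
  ultimately have "span (q ` {1..n}) \<subseteq> V" by (rule span_minimal[rotated])
  then have "b \<in> V" for b unfolding span_configuration by blast
  then have "\<forall>b. \<exists>K. \<forall>z\<in>dual. \<bar>z \<bullet> b\<bar> \<le> K" unfolding V_def by blast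
  then obtain K where K: "\<And>b z. z \<in> dual \<Longrightarrow> \<bar>z \<bullet> b\<bar> \<le> K b" by metis
  have "norm z \<le> (\<Sum>b\<in>Basis. K b)" if "z \<in> dual" for z
    using norm_le_l1[of z] sum_mono[of Basis "\<lambda>b. \<bar>z \<bullet> b\<bar>" K] K[OF that] by force
  then show ?thesis by (auto simp: bounded_iff)
qed

lemma polytope_dual: "polytope dual"
  using polyhedron_dual bounded_dual by (simp add: polytope_eq_bounded_polyhedron)

lemma zero_in_interior_dual: "0 \<in> interior dual"
proof (rule interiorI)
  show "open (\<Inter>i\<in>{1..n}. {z. 0 < 1 + z \<bullet> q i})"
    by (intro open_INT ballI open_Collect_less continuous_intros) auto
qed (auto simp: dual_def less_imp_le)

lemma aff_dim_dual: "aff_dim dual = DIM('a)"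
  using zero_in_interior_dual by (intro aff_dim_nonempty_interior) auto

lemma affine_hull_dual: "affine hull dual = UNIV"
  using zero_in_interior_dual by (intro affine_hull_nonempty_interior) auto

end

text \<open>
  Every label occurs at a vertex, so that no inequality of the polar is redundant.
\<close>

locale covered_general_configuration = centred_general_configuration +
  assumes covered: "\<And>i. i \<in> {1..n} \<Longrightarrow> \<exists>S. cofacet S \<and> i \<in> S"
begin

lemma vertex_on_side:
  assumes "i \<in> {1..n}"
  obtains z where "z \<in> dual" "card (tight z) = DIM('a)" "i \<in> tight z"
proof -
  from covered[OF assms] obtain S where S: "cofacet S" "i \<in> S" by blast
  obtain z where "z extreme_point_of dual" "tight z = S" by (rule vertex_of_cofacet[OF S(1)])
  then show thesis using S(2) by (intro that[of z]) (auto simp: extreme_point_of_dual_iff)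
qed

text \<open>
  Step backwards over the side \<open>i\<close> along the edge direction at a vertex on that side.
\<close>

lemma violates_only:
  assumes i: "i \<in> {1..n}"
  obtains w where "1 + w \<bullet> q i < 0" "\<And>j. j \<in> {1..n} \<Longrightarrow> j \<noteq> i \<Longrightarrow> 0 \<le> 1 + w \<bullet> q j"
proof -
  obtain z where z: "z \<in> dual" "card (tight z) = DIM('a)" "i \<in> tight z"
    by (rule vertex_on_side[OF i])
  obtain u where u: "u \<bullet> q i = 1" "\<And>k. k \<in> tight z \<Longrightarrow> k \<noteq> i \<Longrightarrow> u \<bullet> q k = 0"
    by (rule edge_direction[OF z(2,3)]) (rule that; blast)
  obtain \<epsilon> where \<epsilon>: "0 < \<epsilon>" "\<And>j. j \<in> {1..n} - tight z \<Longrightarrow> \<epsilon> * \<bar>u \<bullet> q j\<bar> < 1 + z \<bullet> q j"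
    by (rule small_move[OF z(1), where u = u]) (rule that; blast)
  show thesis
  proof (rule that[of "z + (- \<epsilon>) *\<^sub>R u"])
    show "1 + (z + (- \<epsilon>) *\<^sub>R u) \<bullet> q i < 0"
      unfolding slack_move using u(1) \<epsilon>(1) z(3) by (simp add: tight_def)
    fix j assume j: "j \<in> {1..n}" "j \<noteq> i"
    show "0 \<le> 1 + (z + (- \<epsilon>) *\<^sub>R u) \<bullet> q j"
    proof (cases "j \<in> tight z")
      case True
      then show ?thesis unfolding slack_move u(2)[OF True j(2)] by (simp add: tight_def)
    next
      case False
      have "\<bar>\<epsilon> * (u \<bullet> q j)\<bar> < 1 + z \<bullet> q j" using \<epsilon>(2)[of j] \<epsilon>(1) False j by (simp add: abs_mult)
      then show ?thesis unfolding slack_move by linarith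
    qed
  qed
qed

text \<open>
  If a vertex on side \<open>i\<close> is also on side \<open>j\<close>, step along the edge that leaves side \<open>j\<close> only.
\<close>

lemma inj_on_side: "inj_on side {1..n}"
proof (rule inj_onI, rule ccontr)
  fix i j assume ij: "i \<in> {1..n}" "j \<in> {1..n}" "side i = side j" "i \<noteq> j"
  obtain z where z: "z \<in> dual" "card (tight z) = DIM('a)" "i \<in> tight z"
    by (rule vertex_on_side[OF ij(1)])
  then have "z \<in> side i" by (simp add: side_def tight_def)
  then have "z \<in> side j" using ij by simp
  then have jz: "j \<in> tight z" using ij by (simp add: side_def tight_def)
  obtain u where u: "u \<bullet> q j = 1" "\<And>k. k \<in> tight z \<Longrightarrow> k \<noteq> j \<Longrightarrow> u \<bullet> q k = 0"
    by (rule edge_direction[OF z(2) jz]) (rule that; blast)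
  obtain \<epsilon> where \<epsilon>: "0 < \<epsilon>" "\<And>j. j \<in> {1..n} - tight z \<Longrightarrow> \<epsilon> * \<bar>u \<bullet> q j\<bar> < 1 + z \<bullet> q j"
    by (rule small_move[OF z(1), where u = u]) (rule that; blast)
  have "z + \<epsilon> *\<^sub>R u \<in> dual"
    unfolding dual_def mem_Collect_eq
  proof
    fix k assume k: "k \<in> {1..n}"
    consider "k = j" | "k \<noteq> j" "k \<in> tight z" | "k \<notin> tight z" by blast
    then show "0 \<le> 1 + (z + \<epsilon> *\<^sub>R u) \<bullet> q k"
    proof cases
      case 1
      then show ?thesis unfolding slack_move using u(1) jz \<epsilon>(1) by (simp add: tight_def)
    next
      case 2
      then show ?thesis unfolding slack_move u(2)[OF 2(2,1)] by (simp add: tight_def)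
    next
      case 3
      have "\<bar>\<epsilon> * (u \<bullet> q k)\<bar> < 1 + z \<bullet> q k" using \<epsilon>(2)[of k] \<epsilon>(1) 3 k by (simp add: abs_mult)
      then show ?thesis unfolding slack_move by linarith
    qed
  qed
  moreover have "1 + (z + \<epsilon> *\<^sub>R u) \<bullet> q i = 0"
    unfolding slack_move u(2)[OF z(3) ij(4)] using z(3) by (simp add: tight_def)
  moreover have "1 + (z + \<epsilon> *\<^sub>R u) \<bullet> q j \<noteq> 0"
    unfolding slack_move using u(1) jz \<epsilon>(1) by (simp add: tight_def)
  ultimately have "z + \<epsilon> *\<^sub>R u \<in> side i" "z + \<epsilon> *\<^sub>R u \<notin> side j" by (auto simp: side_def)
  with ij(3) show False by simp
qed

lemma facet_of_dual_iff: "G facet_of dual \<longleftrightarrow> (\<exists>i\<in>{1..n}. G = side i)"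
proof -
  define h where "h i = {z. (- q i) \<bullet> z \<le> 1}" for i
  have h_iff: "z \<in> h i \<longleftrightarrow> 0 \<le> 1 + z \<bullet> q i" for z i
    by (auto simp: h_def inner_commute)
  have inj: "inj_on h {1..n}"
  proof (rule inj_onI, rule ccontr)
    fix i j assume ij: "i \<in> {1..n}" "j \<in> {1..n}" "h i = h j" "i \<noteq> j"
    obtain w where "1 + w \<bullet> q i < 0" "\<And>j. j \<in> {1..n} \<Longrightarrow> j \<noteq> i \<Longrightarrow> 0 \<le> 1 + w \<bullet> q j"
      by (rule violates_only[OF ij(1)]) (rule that; blast)
    then have "w \<notin> h i" "w \<in> h j" using ij(2,4) unfolding h_iff by auto
    with ij(3) show False by simp
  qed
  \<comment> \<open>Facets of a polyhedron are described through a normal vector for each half-space, so the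
    label has to be recovered from the half-space.\<close>
  define a where "a H = - q (inv_into {1..n} h H)" for H
  have a_h: "a (h i) = - q i" if "i \<in> {1..n}" for i
    using inv_into_f_f[OF inj that] by (simp add: a_def)
  have "G facet_of dual \<longleftrightarrow> (\<exists>H. H \<in> h ` {1..n} \<and> G = dual \<inter> {x. a H \<bullet> x = 1})"
  proof (rule facet_of_polyhedron_explicit)
    show "dual = affine hull dual \<inter> \<Inter>(h ` {1..n})"
      unfolding affine_hull_dual by (auto simp: dual_def h_iff)
  next
    fix H assume "H \<in> h ` {1..n}"
    then obtain i where i: "i \<in> {1..n}" "H = h i" by blast
    obtain z where z: "z \<in> dual" "card (tight z) = DIM('a)" "i \<in> tight z"
      by (rule vertex_on_side[OF i(1)])
    from z(3) have "q i \<noteq> 0" by (auto simp: tight_def)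
    then show "a H \<noteq> 0 \<and> H = {x. a H \<bullet> x \<le> 1}" using i a_h by (simp add: h_def)
  next
    fix F' assume F': "F' \<subset> h ` {1..n}"
    then obtain i where i: "i \<in> {1..n}" "h i \<notin> F'" by blast
    obtain w where w: "1 + w \<bullet> q i < 0" "\<And>j. j \<in> {1..n} \<Longrightarrow> j \<noteq> i \<Longrightarrow> 0 \<le> 1 + w \<bullet> q j"
      by (rule violates_only[OF i(1)]) (rule that; blast)
    have "w \<in> \<Inter>F'"
    proof
      fix H assume "H \<in> F'"
      then obtain j where "j \<in> {1..n}" "H = h j" "j \<noteq> i" using F' i by blast
      then show "w \<in> H" using w(2) by (simp add: h_iff)
    qed
    moreover have "w \<notin> dual" using w(1) i(1) by (force simp: dual_def)
    moreover have "dual \<subseteq> \<Inter>F'" using F' by (force simp: dual_def h_iff)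
    ultimately show "dual \<subset> affine hull dual \<inter> \<Inter>F'" unfolding affine_hull_dual by auto
  qed simp
  also have "\<dots> \<longleftrightarrow> (\<exists>i\<in>{1..n}. G = dual \<inter> {x. a (h i) \<bullet> x = 1})" by blast
  also have "\<dots> \<longleftrightarrow> (\<exists>i\<in>{1..n}. G = side i)"
  proof (rule bex_cong[OF refl])
    fix i assume "i \<in> {1..n}"
    then have "a (h i) = - q i" by (rule a_h)
    then have "dual \<inter> {x. a (h i) \<bullet> x = 1} = side i"
      unfolding side_def by (auto simp: inner_commute)
    then show "(G = dual \<inter> {x. a (h i) \<bullet> x = 1}) = (G = side i)" by simp
  qed
  finally show ?thesis .
qed

lemma bij_betw_side: "bij_betw side {1..n} {G. G facet_of dual}"
  using inj_on_side by (auto simp: bij_betw_def facet_of_dual_iff)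

lemma facets_through:
  assumes "z \<in> dual"
  shows "{G. G facet_of dual \<and> z \<in> G} = side ` tight z"
  using assms by (auto simp: facet_of_dual_iff side_def tight_def)

lemma simple_polytope_dual: "simple_polytope DIM('a) dual"
  unfolding simple_polytope_def
proof (intro conjI allI impI polytope_dual)
  show "aff_dim dual = int DIM('a)" by (rule aff_dim_dual)
  fix v assume "v extreme_point_of dual"
  then have v: "v \<in> dual" "card (tight v) = DIM('a)" by (auto simp: extreme_point_of_dual_iff)
  show "card {G. G facet_of dual \<and> v \<in> G} = DIM('a)"
    unfolding facets_through[OF v(1)]
    using card_image[OF inj_on_subset[OF inj_on_side tight_subset]] v(2) by simp
qed

lemma facet_labels_side:
  assumes "v \<in> dual"
  shows "facet_labels n side v = tight v"
  using assms by (auto simp: facet_labels_def side_def tight_def)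

lemma bij_betw_facet_labels:
  "bij_betw (facet_labels n side) {v. v extreme_point_of dual} {S. cofacet S}"
  using bij_betw_tight
  by (rule bij_betw_cong[THEN iffD1, rotated])
     (simp add: facet_labels_side extreme_point_of_dual_iff)

lemma polar_to_neighborly_dual:
  assumes nb: "\<And>I. I \<subseteq> {1..n} \<Longrightarrow> card I \<le> DIM('a) div 2 \<Longrightarrow> \<exists>S. cofacet S \<and> I \<subseteq> S"
  shows "polar_to_neighborly DIM('a) dual"
  unfolding polar_to_neighborly_def
proof (intro conjI allI impI simple_polytope_dual)
  fix \<G> assume \<G>: "\<G> \<subseteq> {G. G facet_of dual} \<and> finite \<G> \<and> card \<G> \<le> DIM('a) div 2"
  then obtain I where I: "I \<subseteq> {1..n}" "\<G> = side ` I"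
    by (metis bij_betw_side bij_betw_imp_surj_on subset_imageE)
  have "card I \<le> DIM('a) div 2"
    using \<G> card_image[OF inj_on_subset[OF inj_on_side I(1)]] I(2) by simp
  from nb[OF I(1) this] obtain S where S: "cofacet S" "I \<subseteq> S" by blast
  obtain z where z: "z extreme_point_of dual" "tight z = S" by (rule vertex_of_cofacet[OF S(1)])
  then have "z \<in> dual \<inter> \<Inter>\<G>" using S(2) I(2)
    by (auto simp: extreme_point_of_dual_iff side_def tight_def)
  then show "dual \<inter> \<Inter>\<G> \<noteq> {}" by blast
qed

end

section \<open>Unions of disjoint pairs\<close>

text \<open>
  The unions of \<open>g\<close> disjoint pairs of neighbours in \<open>{a..b}\<close>, described through their
  leftmost pair.
\<close>

fun pair_unions :: "nat \<Rightarrow> nat \<Rightarrow> nat \<Rightarrow> nat set set" where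
  "pair_unions 0 a b = {{}}"
| "pair_unions (Suc g) a b = {{j, j + 1} \<union> T | j T. a \<le> j \<and> j < b \<and> T \<in> pair_unions g (j + 2) b}"

lemma pair_unions_mono: "a' \<le> a \<Longrightarrow> pair_unions g a b \<subseteq> pair_unions g a' b"
  by (cases g) (auto intro: le_trans)

lemma pair_unions_SucI:
  "a \<le> j \<Longrightarrow> j < b \<Longrightarrow> T \<in> pair_unions g (j + 2) b \<Longrightarrow> {j, j + 1} \<union> T \<in> pair_unions (Suc g) a b"
  unfolding pair_unions.simps by blast

lemma pair_unionsD:
  assumes "T \<in> pair_unions g a b"
  shows "T \<subseteq> {a..b} \<and> card T = 2 * g \<and> (\<forall>x\<in>{a..b} - T. even (card {s \<in> T. x < s}))"
  using assms
proof (induction g arbitrary: a T)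
  case (Suc g)
  then obtain j U where T: "T = {j, j + 1} \<union> U" "a \<le> j" "j < b" "U \<in> pair_unions g (j + 2) b"
    by auto
  from Suc.IH[OF T(4)] have U: "U \<subseteq> {j + 2..b}" "card U = 2 * g"
    and ev: "\<And>x. x \<in> {j + 2..b} - U \<Longrightarrow> even (card {s \<in> U. x < s})" by auto
  have fin: "finite U" using U(1) finite_subset by blast
  have notin: "j \<notin> U" "j + 1 \<notin> U" using U(1) by auto
  then have card: "card T = 2 * Suc g" using fin U(2) by (simp add: T(1))
  have "even (card {s \<in> T. x < s})" if x: "x \<in> {a..b} - T" for x
  proof (cases "x < j")
    case True
    then have "{s \<in> T. x < s} = T" using U(1) by (auto simp: T(1))
    then show ?thesis using card by simp
  next
    case False
    then have "x \<in> {j + 2..b} - U" using x by (auto simp: T(1))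
    moreover from this have "{s \<in> T. x < s} = {s \<in> U. x < s}" by (auto simp: T(1))
    ultimately show ?thesis using ev by simp
  qed
  moreover have "T \<subseteq> {a..b}" using U(1) T(2,3) by (auto simp: T(1))
  ultimately show ?case using card by blast
qed simp

lemma pair_unionsI:
  assumes "T \<subseteq> {a..b}" "card T = 2 * g" "\<And>x. x \<in> {a..b} - T \<Longrightarrow> even (card {s \<in> T. x < s})"
  shows "T \<in> pair_unions g a b"
  using assms
proof (induction "Suc b - a" arbitrary: a T g rule: less_induct)
  case less
  have fin: "finite T" using less.prems(1) finite_subset by blast
  show ?case
  proof (cases "T = {}")
    case True
    then show ?thesis using less.prems(2) by simp
  next
    case False
    then have ab: "a \<le> b" using less.prems(1) by auto
    show ?thesis
    proof (cases "a \<in> T")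
      case False
      have "T \<in> pair_unions g (Suc a) b"
      proof (rule less.hyps)
        show "T \<subseteq> {Suc a..b}"
        proof
          fix x assume "x \<in> T"
          then show "x \<in> {Suc a..b}" using less.prems(1) False by (cases "x = a") force+
        qed
      qed (use ab less.prems in auto)
      then show ?thesis using pair_unions_mono[of a "Suc a"] by auto
    next
      case True
      have tail_a: "{s \<in> T. a < s} = T - {a}" using less.prems(1) by force
      have "Suc a \<in> T"
      proof (rule ccontr)
        assume Sa: "Suc a \<notin> T"
        have "T \<noteq> {a}" using less.prems(2) by auto
        then obtain t where "t \<in> T" "t \<noteq> a" using True by blast
        then have "a < t" "t \<le> b" using less.prems(1) by force+
        then have "Suc a \<in> {a..b} - T" using Sa by simp
        then have "even (card {s \<in> T. Suc a < s})" by (rule less.prems(3))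
        moreover have "Suc a < s \<longleftrightarrow> a < s" if "s \<in> T" for s
        proof -
          have "s \<noteq> Suc a" using that Sa by blast
          then show ?thesis by linarith
        qed
        then have "{s \<in> T. Suc a < s} = T - {a}" using tail_a by blast
        ultimately show False using less.prems(2) True fin by simp
      qed
      define U where "U = T - {a, a + 1}"
      have T: "T = {a, a + 1} \<union> U" using True \<open>Suc a \<in> T\<close> by (auto simp: U_def)
      have "a \<notin> U" "a + 1 \<notin> U" "finite U" using fin by (auto simp: U_def)
      then have cT: "card T = Suc (Suc (card U))" by (subst T) simp
      then obtain g' where g: "g = Suc g'" using less.prems(2) by (cases g) auto
      have "U \<in> pair_unions g' (a + 2) b"
      proof (rule less.hyps)
        show "Suc b - (a + 2) < Suc b - a" using ab by simp
        show "U \<subseteq> {a + 2..b}"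
        proof
          fix x assume "x \<in> U"
          then have "x \<in> T" "x \<noteq> a" "x \<noteq> a + 1" by (auto simp: U_def)
          moreover from this have "a \<le> x" "x \<le> b" using less.prems(1) by auto
          ultimately show "x \<in> {a + 2..b}" by simp
        qed
        show "card U = 2 * g'" using cT less.prems(2) g by simp
        fix x assume x: "x \<in> {a + 2..b} - U"
        then have eq: "{s \<in> U. x < s} = {s \<in> T. x < s}" by (auto simp: U_def)
        have "x \<in> {a..b} - T" using x by (auto simp: U_def)
        then show "even (card {s \<in> U. x < s})" unfolding eq by (rule less.prems(3))
      qed
      moreover have "a < b" using \<open>Suc a \<in> T\<close> less.prems(1) by auto
      ultimately show ?thesis unfolding g by (subst T) (rule pair_unions_SucI; simp)
    qed
  qed
qed

text \<open>
  Gale's evenness condition: a set of even size is a union of disjoint pairs of neighbours if and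
  only if an even number of its elements lies beyond each element of its complement.
\<close>

lemma pair_unions_iff:
  "T \<in> pair_unions g a b \<longleftrightarrow>
     T \<subseteq> {a..b} \<and> card T = 2 * g \<and> (\<forall>x\<in>{a..b} - T. even (card {s \<in> T. x < s}))"
  using pair_unionsD pair_unionsI by blast

text \<open>
  Going from left to right, start a pair at each element of \<open>I\<close> that is not covered yet. Once the
  remaining interval has just enough room for the remaining pairs, they fill it completely.
\<close>

lemma pair_unions_cover:
  assumes "I \<subseteq> {a..b}" "card I \<le> g" "2 * g \<le> Suc b - a"
  shows "\<exists>T\<in>pair_unions g a b. I \<subseteq> T"
  using assms
proof (induction "Suc b - a" arbitrary: a I g rule: less_induct)
  case less
  have fin: "finite I" using less.prems(1) finite_subset by blast
  consider "g = 0" | "g \<noteq> 0" "a \<in> I" | "g \<noteq> 0" "a \<notin> I" "2 * g \<le> Suc b - Suc a" | "2 * g = Suc b - a"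
    using less.prems(3) by linarith
  then show ?case
  proof cases
    case 1
    then show ?thesis using less.prems(2) fin by simp
  next
    case 2
    then obtain g' where g: "g = Suc g'" by (cases g) auto
    have "card (I - {a, a + 1}) \<le> card (I - {a})" using fin by (intro card_mono) auto
    also have "\<dots> \<le> g'" using 2 fin less.prems(2) g by simp
    finally have c: "card (I - {a, a + 1}) \<le> g'" .
    have "\<exists>T\<in>pair_unions g' (a + 2) b. I - {a, a + 1} \<subseteq> T"
    proof (rule less.hyps[OF _ _ c])
      show "I - {a, a + 1} \<subseteq> {a + 2..b}"
      proof
        fix x assume "x \<in> I - {a, a + 1}"
        then have "x \<noteq> a" "x \<noteq> a + 1" "a \<le> x" "x \<le> b" using less.prems(1) by auto
        then show "x \<in> {a + 2..b}" by simp
      qed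
    qed (use less.prems(3) g in auto)
    then obtain T where T: "T \<in> pair_unions g' (a + 2) b" "I - {a, a + 1} \<subseteq> T" by blast
    have "{a, a + 1} \<union> T \<in> pair_unions g a b"
      unfolding g by (rule pair_unions_SucI) (use T(1) less.prems(3) g in auto)
    then show ?thesis using T(2) by blast
  next
    case 3
    have "\<exists>T\<in>pair_unions g (Suc a) b. I \<subseteq> T"
    proof (rule less.hyps[OF _ _ less.prems(2) 3(3)])
      show "I \<subseteq> {Suc a..b}"
      proof
        fix x assume "x \<in> I"
        then show "x \<in> {Suc a..b}" using less.prems(1) 3(2) by (cases "x = a") force+
      qed
    qed (use 3 in auto)
    then show ?thesis using pair_unions_mono[of a "Suc a" g b] by auto
  next
    case 4
    then have "{a..b} \<in> pair_unions g a b" by (intro pair_unionsI) auto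
    then show ?thesis using less.prems(1) by blast
  qed
qed

text \<open>
  The form in which the three types present their pairs; the first index \<open>l\<close> is 1 or 2
  there.
\<close>

lemma pair_unions_indexed:
  "T \<in> pair_unions (Suc g) a b \<longleftrightarrow>
    (\<exists>j :: nat \<Rightarrow> nat. a \<le> j l \<and> (\<forall>k. l \<le> k \<and> k < l + g \<longrightarrow> j k + 2 \<le> j (k + 1)) \<and>
       j (l + g) < b \<and> T = (\<Union>k\<in>{l..l + g}. {j k, j k + 1}))"
proof (induction g arbitrary: a l T)
  case 0
  show ?case
  proof
    assume "T \<in> pair_unions (Suc 0) a b"
    then obtain i where "a \<le> i" "i < b" "T = {i, i + 1}" by auto
    then show "\<exists>j :: nat \<Rightarrow> nat. a \<le> j l \<and> (\<forall>k. l \<le> k \<and> k < l + 0 \<longrightarrow> j k + 2 \<le> j (k + 1)) \<and>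
        j (l + 0) < b \<and> T = (\<Union>k\<in>{l..l + 0}. {j k, j k + 1})"
      by (intro exI[of _ "\<lambda>_. i"]) auto
  qed auto
next
  case (Suc g)
  have split: "{l..l + Suc g} = insert l {Suc l..Suc l + g}" by auto
  show ?case
  proof
    assume "T \<in> pair_unions (Suc (Suc g)) a b"
    then obtain i U where T: "a \<le> i" "T = {i, i + 1} \<union> U" "U \<in> pair_unions (Suc g) (i + 2) b"
      unfolding pair_unions.simps(2)[of "Suc g"] by blast
    from T(3) obtain j where
      j: "i + 2 \<le> j (Suc l)" "\<And>k. Suc l \<le> k \<Longrightarrow> k < Suc l + g \<Longrightarrow> j k + 2 \<le> j (k + 1)"
        "j (Suc l + g) < b" "U = (\<Union>k\<in>{Suc l..Suc l + g}. {j k, j k + 1})"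
      unfolding Suc.IH[of U "i + 2" "Suc l"] by blast
    let ?j = "j(l := i)"
    have "U = (\<Union>k\<in>{Suc l..Suc l + g}. {?j k, ?j k + 1})" unfolding j(4) by auto
    then have "T = (\<Union>k\<in>{l..l + Suc g}. {?j k, ?j k + 1})" unfolding split T(2) by simp
    moreover have "?j k + 2 \<le> ?j (k + 1)" if "l \<le> k" "k < l + Suc g" for k
      using that j(1) j(2)[of k] by (cases "k = l") auto
    ultimately show "\<exists>j :: nat \<Rightarrow> nat. a \<le> j l \<and>
        (\<forall>k. l \<le> k \<and> k < l + Suc g \<longrightarrow> j k + 2 \<le> j (k + 1)) \<and>
        j (l + Suc g) < b \<and> T = (\<Union>k\<in>{l..l + Suc g}. {j k, j k + 1})"
      using T(1) j(3) by (intro exI[of _ ?j]) auto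
  next
    assume "\<exists>j :: nat \<Rightarrow> nat. a \<le> j l \<and>
        (\<forall>k. l \<le> k \<and> k < l + Suc g \<longrightarrow> j k + 2 \<le> j (k + 1)) \<and>
        j (l + Suc g) < b \<and> T = (\<Union>k\<in>{l..l + Suc g}. {j k, j k + 1})"
    then obtain j :: "nat \<Rightarrow> nat" where j: "a \<le> j l"
        "\<And>k. l \<le> k \<Longrightarrow> k < l + Suc g \<Longrightarrow> j k + 2 \<le> j (k + 1)" "j (l + Suc g) < b"
        and T: "T = (\<Union>k\<in>{l..l + Suc g}. {j k, j k + 1})" by blast
    let ?U = "\<Union>k\<in>{Suc l..Suc l + g}. {j k, j k + 1}"
    have next_pair: "j l + 2 \<le> j (Suc l)" using j(2)[of l] by simp
    have U: "?U \<in> pair_unions (Suc g) (j l + 2) b"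
      unfolding Suc.IH[of ?U "j l + 2" "Suc l"]
      by (rule exI[of _ j]) (use next_pair j(2,3) in auto)
    have "j (Suc l) \<in> ?U" by force
    then have "j (Suc l) \<le> b" using pair_unionsD[OF U] by (meson atLeastAtMost_iff subsetD)
    then have "j l < b" using next_pair by simp
    moreover have "T = {j l, j l + 1} \<union> ?U" unfolding T split by simp
    ultimately show "T \<in> pair_unions (Suc (Suc g)) a b"
      using pair_unions_SucI[OF j(1) _ U] by simp
  qed
qed

declare pair_unions.simps(2) [simp del]

section \<open>Label sets with all other points on one side\<close>

text \<open>
  Row 1 is the second row, as rows are counted from 0. Hence the diagonal term of a minor has the
  sign given by the parity of its second smallest column.
\<close>

definition alternating_second :: "nat \<Rightarrow> nat \<Rightarrow> real" where
  "alternating_second k i = (if k = 1 then (-1) ^ i else 1)"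

lemma lex_sign_alternating_second:
  assumes "a < b" "finite C" "\<And>c. c \<in> C \<Longrightarrow> b < c"
  shows "lex_sign alternating_second (insert a (insert b C)) = (-1) ^ b"
proof -
  let ?A = "insert a (insert b C)"
  have "alternating_second (card {x \<in> ?A. x < y}) y = (if y = b then (-1) ^ b else 1)" if "y \<in> ?A" for y
  proof -
    from that consider "y = a" | "y = b" | "y \<in> C" by blast
    then show ?thesis
    proof cases
      case 1
      have e: "{x \<in> ?A. x < a} = {}" using assms by force
      show ?thesis unfolding 1 e using assms(1) by (simp add: alternating_second_def)
    next
      case 2
      have e: "{x \<in> ?A. x < b} = {a}" using assms by force
      show ?thesis unfolding 2 e by (simp add: alternating_second_def)
    next
      case 3
      have "{a, b} \<subseteq> {x \<in> ?A. x < y}" using assms(1) assms(3)[OF 3] by auto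
      from card_mono[OF _ this] have "card {x \<in> ?A. x < y} \<noteq> 1" using assms(1,2) by auto
      moreover have "y \<noteq> b" using assms(3)[OF 3] by simp
      ultimately show ?thesis by (simp only: alternating_second_def if_False)
    qed
  qed
  then have "lex_sign alternating_second ?A = (\<Prod>y\<in>?A. if y = b then (-1) ^ b else 1)"
    unfolding lex_sign_def by (intro prod.cong) auto
  also have "\<dots> = (-1) ^ b" using assms(2) by (subst prod.delta) auto
  finally show ?thesis .
qed

text \<open>
  The side of the hyperplane through the points labelled by \<open>S\<close> on which the point labelled
  \<open>x\<close> lies.
\<close>

definition position_sign :: "nat set \<Rightarrow> nat \<Rightarrow> real" where
  "position_sign S x = (-1) ^ card {s \<in> S. x < s} * lex_sign alternating_second (insert x S)"

definition one_sided :: "nat \<Rightarrow> nat set \<Rightarrow> bool" where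
  "one_sided n S \<longleftrightarrow> (\<forall>x\<in>{1..n} - S. \<forall>y\<in>{1..n} - S. position_sign S x = position_sign S y)"

text \<open>
  The sets in question split into their two smallest elements \<open>s < r\<close> and the rest \<open>T\<close>, of even
  size. The second smallest element of \<open>insert x S\<close> is \<open>s\<close>, \<open>x\<close> or \<open>r\<close>, according to the
  position of \<open>x\<close>.
\<close>

lemma position_sign_eq:
  assumes sr: "s < r" and T: "finite T" "\<And>t. t \<in> T \<Longrightarrow> r < t" "even (card T)"
    and x: "x \<notin> {s, r} \<union> T"
  shows "position_sign ({s, r} \<union> T) x =
    (-1) ^ (if x < s then s else if x < r then x + 1 else card {t \<in> T. x < t} + r)"
proof -
  have notin: "s \<notin> T" "r \<notin> T" "s \<noteq> r" using sr T(2) by force+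
  consider "x < s" | "s < x" "x < r" | "r < x" using x by force
  then show ?thesis
  proof cases
    case 1
    have "{a \<in> {s, r} \<union> T. x < a} = insert s (insert r T)" using 1 sr T(2) by force
    then have c: "card {a \<in> {s, r} \<union> T. x < a} = Suc (Suc (card T))" using notin T(1) by simp
    have "lex_sign alternating_second (insert x (insert s (insert r T))) = (-1) ^ s"
      by (rule lex_sign_alternating_second) (use 1 sr T in force)+
    then show ?thesis unfolding position_sign_def c using 1 T(3) by simp
  next
    case 2
    have "{a \<in> {s, r} \<union> T. x < a} = insert r T" using 2 sr T(2) by force
    then have c: "card {a \<in> {s, r} \<union> T. x < a} = Suc (card T)" using notin T(1) by simp
    have "lex_sign alternating_second (insert s (insert x (insert r T))) = (-1) ^ x"
      by (rule lex_sign_alternating_second) (use 2 sr T in force)+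
    then show ?thesis unfolding position_sign_def c using 2 T(3) by (simp add: insert_commute)
  next
    case 3
    have c: "{a \<in> {s, r} \<union> T. x < a} = {t \<in> T. x < t}" using 3 sr by force
    have "lex_sign alternating_second (insert s (insert r (insert x T))) = (-1) ^ r"
      by (rule lex_sign_alternating_second) (use 3 sr T in force)+
    then show ?thesis unfolding position_sign_def c using 3 sr by (simp add: insert_commute power_add)
  qed
qed

text \<open>
  When the tails are odd instead of even, an even set starts at the left end and stops at the right
  end of the interval; without these two elements the tails are even.
\<close>

lemma odd_tails_iff:
  assumes T: "T \<subseteq> {a..n}" "card T = 2 * g + 2"
  shows "(\<forall>x\<in>{a..n} - T. odd (card {t \<in> T. x < t})) \<longleftrightarrow>
    a < n \<and> (\<exists>U\<in>pair_unions g (a + 1) (n - 1). T = {a, n} \<union> U)"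
proof
  assume odd: "\<forall>x\<in>{a..n} - T. odd (card {t \<in> T. x < t})"
  have fin: "finite T" using T(1) finite_subset by blast
  have "T \<noteq> {}" using T(2) by auto
  then have an: "a \<le> n" using T(1) by auto
  have a: "a \<in> T"
  proof (rule ccontr)
    assume "a \<notin> T"
    have "a < t" if "t \<in> T" for t
    proof -
      have "t \<noteq> a" "a \<le> t" using that \<open>a \<notin> T\<close> T(1) by auto
      then show ?thesis by simp
    qed
    then have e: "{t \<in> T. a < t} = T" by blast
    have "odd (card {t \<in> T. a < t})" using odd \<open>a \<notin> T\<close> an by simp
    then show False unfolding e using T(2) by simp
  qed
  have n: "n \<in> T"
  proof (rule ccontr)
    assume "n \<notin> T"
    have e: "{t \<in> T. n < t} = {}" using T(1) by force
    have "odd (card {t \<in> T. n < t})" using odd \<open>n \<notin> T\<close> an by simp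
    then show False unfolding e by simp
  qed
  have "a \<noteq> n"
  proof
    assume "a = n"
    then have "T = {a}" using a T(1) by auto
    then show False using T(2) by simp
  qed
  define U where "U = T - {a, n}"
  have TU: "T = {a, n} \<union> U" using a n by (auto simp: U_def)
  have finU: "finite U" and notin: "a \<notin> U" "n \<notin> U" using fin by (auto simp: U_def)
  have "U \<in> pair_unions g (a + 1) (n - 1)"
  proof (rule pair_unionsI)
    show "U \<subseteq> {a + 1..n - 1}"
    proof
      fix x assume "x \<in> U"
      then have "x \<noteq> a" "x \<noteq> n" "a \<le> x" "x \<le> n" using T(1) by (auto simp: U_def)
      then show "x \<in> {a + 1..n - 1}" by simp
    qed
    have "card T = Suc (Suc (card U))" using finU notin \<open>a \<noteq> n\<close> by (subst TU) simp
    then show "card U = 2 * g" using T(2) by simp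
    fix x assume x: "x \<in> {a + 1..n - 1} - U"
    then have "x \<in> {a..n} - T" by (auto simp: U_def)
    with odd have "odd (card {t \<in> T. x < t})" by blast
    moreover have "{t \<in> T. x < t} = insert n {t \<in> U. x < t}" using x by (subst TU) auto
    ultimately show "even (card {t \<in> U. x < t})" using finU notin by simp
  qed
  then show "a < n \<and> (\<exists>U\<in>pair_unions g (a + 1) (n - 1). T = {a, n} \<union> U)"
    using TU an \<open>a \<noteq> n\<close> by auto
next
  assume "a < n \<and> (\<exists>U\<in>pair_unions g (a + 1) (n - 1). T = {a, n} \<union> U)"
  then obtain U where U: "U \<in> pair_unions g (a + 1) (n - 1)" "T = {a, n} \<union> U" "a < n" by blast
  note D = pair_unionsD[OF U(1)]
  show "\<forall>x\<in>{a..n} - T. odd (card {t \<in> T. x < t})"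
  proof
    fix x assume x: "x \<in> {a..n} - T"
    then have "x \<noteq> a" "x \<noteq> n" using U(2) by auto
    then have "x \<in> {a + 1..n - 1} - U" using x U(2) by auto
    then have "even (card {t \<in> U. x < t})" using D by blast
    moreover have "{t \<in> T. x < t} = insert n {t \<in> U. x < t}"
      using x \<open>x \<noteq> n\<close> by (auto simp: U(2))
    moreover have "finite U" "n \<notin> U" using D U(3) finite_subset by auto
    ultimately show "odd (card {t \<in> T. x < t})" by simp
  qed
qed

lemma minus_one_power_eq_iff: "(-1 :: real) ^ a = (-1) ^ b \<longleftrightarrow> (even a \<longleftrightarrow> even b)"
  by (cases "even a"; cases "even b") auto

text \<open>
  Between \<open>s\<close> and \<open>r\<close> the side changes from each label to the next, so there is at most one
  label in this gap. If there is one, its sign \<open>(-1)\<^sup>s\<close> forces even tails in \<open>T\<close>. If there is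
  none, the sign at labels below \<open>s\<close> is also \<open>(-1)\<^sup>s\<close> and opposite to \<open>(-1)\<^sup>r\<close>, hence it
  forces odd tails; only for \<open>s = 1\<close>, when there are no such labels, are even tails possible too.
\<close>

lemma one_sided_iff:
  assumes s: "1 \<le> s" and sr: "s < r" and T: "T \<subseteq> {r + 1..n}" "card T = 2 * g + 2"
  shows "one_sided n ({s, r} \<union> T) \<longleftrightarrow>
      r = s + 2 \<and> T \<in> pair_unions (g + 1) (s + 3) n \<or>
      s = 1 \<and> r = 2 \<and> T \<in> pair_unions (g + 1) 3 n \<or>
      r = s + 1 \<and> s + 2 < n \<and> (\<exists>U\<in>pair_unions g (s + 3) (n - 1). T = {s + 2, n} \<union> U)"
proof -
  let ?S = "{s, r} \<union> T"
  \<comment> \<open>The exponent of the sign at \<open>x\<close>.\<close>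
  define e where "e x = (if x < s then s else if x < r then x + 1 else card {t \<in> T. x < t} + r)" for x
  have fin: "finite T" using T(1) finite_subset by blast
  have "T \<noteq> {}" using T(2) by auto
  then have rn: "r < n" using T(1) by auto
  have "position_sign ?S x = (-1) ^ e x" if "x \<in> {1..n} - ?S" for x
    unfolding e_def by (rule position_sign_eq) (use sr fin T that in auto)
  then have one_sided: "one_sided n ?S \<longleftrightarrow>
      (\<forall>x\<in>{1..n} - ?S. \<forall>y\<in>{1..n} - ?S. even (e x) \<longleftrightarrow> even (e y))"
    unfolding one_sided_def by (simp only: minus_one_power_eq_iff cong: ball_cong)
  have above: "e x = card {t \<in> T. x < t} + r" if "r < x" for x using that sr by (simp add: e_def)
  have gap: "e x = x + 1" if "s < x" "x < r" for x using that by (simp add: e_def)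
  have below: "e x = s" if "x < s" for x using that by (simp add: e_def)
  have out_above: "x \<in> {1..n} - ?S" if "x \<in> {r + 1..n} - T" for x using that sr by auto
  have out_gap: "x \<in> {1..n} - ?S" if "s < x" "x < r" for x using that T(1) rn by auto
  have out_below: "x \<in> {1..n} - ?S" if "1 \<le> x" "x < s" for x using that T(1) rn sr by auto
  have outE: "(1 \<le> x \<and> x < s) \<or> (s < x \<and> x < r) \<or> x \<in> {r + 1..n} - T" if "x \<in> {1..n} - ?S" for x
    using that by force
  have even_iff: "T \<in> pair_unions (g + 1) (r + 1) n \<longleftrightarrow>
      (\<forall>x\<in>{r + 1..n} - T. even (card {t \<in> T. x < t}))"
    unfolding pair_unions_iff using T by simp
  have odd_iff: "(\<forall>x\<in>{r + 1..n} - T. odd (card {t \<in> T. x < t})) \<longleftrightarrow>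
      r + 1 < n \<and> (\<exists>U\<in>pair_unions g (r + 2) (n - 1). T = {r + 1, n} \<union> U)"
    using odd_tails_iff[OF T] by simp
  show ?thesis
  proof (cases "r = s + 1")
    case r: True
    have "one_sided n ?S \<longleftrightarrow> s = 1 \<and> (\<forall>x\<in>{r + 1..n} - T. even (card {t \<in> T. x < t})) \<or>
        (\<forall>x\<in>{r + 1..n} - T. odd (card {t \<in> T. x < t}))" (is "_ \<longleftrightarrow> ?R")
    proof
      assume "one_sided n ?S"
      then have c: "\<And>x y. x \<in> {1..n} - ?S \<Longrightarrow> y \<in> {1..n} - ?S \<Longrightarrow> even (e x) \<longleftrightarrow> even (e y)"
        unfolding one_sided by blast
      show ?R
      proof (cases "s = 1")
        case True
        have same: "even (card {t \<in> T. x < t}) \<longleftrightarrow> even (card {t \<in> T. y < t})"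
          if x: "x \<in> {r + 1..n} - T" and y: "y \<in> {r + 1..n} - T" for x y
        proof -
          have "even (e x) \<longleftrightarrow> even (e y)" using x y by (intro c out_above)
          moreover have "r < x" "r < y" using x y by auto
          ultimately show ?thesis by (cases "even r") (simp_all add: above)
        qed
        show ?thesis
        proof (cases "\<exists>x\<in>{r + 1..n} - T. even (card {t \<in> T. x < t})")
          case E: True
          then obtain x where "x \<in> {r + 1..n} - T" "even (card {t \<in> T. x < t})" by blast
          then have "\<forall>y\<in>{r + 1..n} - T. even (card {t \<in> T. y < t})" using same by blast
          then show ?thesis using True by blast
        qed blast
      next
        case False
        then have one: "1 < s" using s by simp
        have "odd (card {t \<in> T. x < t})" if x: "x \<in> {r + 1..n} - T" for x
        proof -
          have "even (e x) \<longleftrightarrow> even (e 1)" using x one by (intro c out_above out_below) auto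
          moreover have "e x = card {t \<in> T. x < t} + r" using x by (intro above) auto
          moreover have "e 1 = s" using one by (intro below)
          ultimately show ?thesis using r by (cases "even s") simp_all
        qed
        then show ?thesis by blast
      qed
    next
      assume R: ?R
      have val: "even (e x) \<longleftrightarrow> (if s = 1 \<and> (\<forall>x\<in>{r + 1..n} - T. even (card {t \<in> T. x < t}))
          then even r else even s)" if x: "x \<in> {1..n} - ?S" for x
      proof -
        from outE[OF x] consider "1 \<le> x" "x < s" | "x \<in> {r + 1..n} - T" using r by force
        then show ?thesis
        proof cases
          case 1
          then show ?thesis using below by simp
        next
          case 2
          then have "e x = card {t \<in> T. x < t} + r" by (intro above) auto
          then show ?thesis using R 2 r by (cases "even s") auto
        qed
      qed
      show "one_sided n ?S" unfolding one_sided by (intro ballI) (simp only: val)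
    qed
    also have "\<dots> \<longleftrightarrow> s = 1 \<and> T \<in> pair_unions (g + 1) (r + 1) n \<or>
        r + 1 < n \<and> (\<exists>U\<in>pair_unions g (r + 2) (n - 1). T = {r + 1, n} \<union> U)"
      unfolding even_iff odd_iff ..
    finally have eq: "one_sided n ?S \<longleftrightarrow> s = 1 \<and> T \<in> pair_unions (g + 1) (r + 1) n \<or>
        r + 1 < n \<and> (\<exists>U\<in>pair_unions g (r + 2) (n - 1). T = {r + 1, n} \<union> U)" .
    have r1: "r + 1 = s + 2" and r2: "r + 2 = s + 3" using r by auto
    have "s = 1 \<and> T \<in> pair_unions (g + 1) (s + 2) n \<longleftrightarrow> s = 1 \<and> r = 2 \<and> T \<in> pair_unions (g + 1) 3 n"
    proof (cases "s = 1")
      case True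
      then have "s + 2 = 3" "r = 2" using r by auto
      then show ?thesis by (simp only:) simp
    qed simp
    moreover have "r \<noteq> s + 2" using r by simp
    ultimately show ?thesis unfolding eq r1 r2 using r by blast
  next
    case False
    have "one_sided n ?S \<longleftrightarrow> r = s + 2 \<and> (\<forall>x\<in>{r + 1..n} - T. even (card {t \<in> T. x < t}))"
      (is "_ \<longleftrightarrow> ?R")
    proof
      assume "one_sided n ?S"
      then have c: "\<And>x y. x \<in> {1..n} - ?S \<Longrightarrow> y \<in> {1..n} - ?S \<Longrightarrow> even (e x) \<longleftrightarrow> even (e y)"
        unfolding one_sided by blast
      have "\<not> s + 2 < r"
      proof
        assume "s + 2 < r"
        then have "even (e (s + 1)) \<longleftrightarrow> even (e (s + 2))" by (intro c out_gap) auto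
        moreover have "e (s + 1) = s + 2" "e (s + 2) = s + 3" using \<open>s + 2 < r\<close> by (simp_all add: gap)
        ultimately show False by simp
      qed
      then have r: "r = s + 2" using False sr by simp
      moreover have "even (card {t \<in> T. x < t})" if x: "x \<in> {r + 1..n} - T" for x
      proof -
        have "even (e x) \<longleftrightarrow> even (e (s + 1))" using x r by (intro c out_above out_gap) auto
        moreover have "e x = card {t \<in> T. x < t} + r" using x by (intro above) auto
        moreover have "e (s + 1) = s + 2" using r by (simp add: gap)
        ultimately show ?thesis using r by (cases "even s") simp_all
      qed
      ultimately show ?R by blast
    next
      assume R: ?R
      have val: "even (e x) \<longleftrightarrow> even s" if x: "x \<in> {1..n} - ?S" for x
        using outE[OF x]
      proof (elim disjE)
        assume "s < x \<and> x < r"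
        then have "x = s + 1" using R by auto
        then show ?thesis using gap[of x] R by simp
      next
        assume x: "x \<in> {r + 1..n} - T"
        then have "e x = card {t \<in> T. x < t} + r" by (intro above) auto
        then show ?thesis using R x by simp
      qed (use below in simp)
      show "one_sided n ?S" unfolding one_sided by (intro ballI) (simp only: val)
    qed
    also have "\<dots> \<longleftrightarrow> r = s + 2 \<and> T \<in> pair_unions (g + 1) (r + 1) n" unfolding even_iff ..
    also have "\<dots> \<longleftrightarrow> r = s + 2 \<and> T \<in> pair_unions (g + 1) (s + 3) n"
    proof (cases "r = s + 2")
      case True
      then have "r + 1 = s + 3" by simp
      then show ?thesis by (simp only:)
    qed simp
    finally have eq: "one_sided n ?S \<longleftrightarrow> r = s + 2 \<and> T \<in> pair_unions (g + 1) (s + 3) n" .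
    have "\<not> (s = 1 \<and> r = 2)" using False by auto
    then show ?thesis unfolding eq using False by blast
  qed
qed

section \<open>The three types of label sets\<close>

lemma type1_eq:
  assumes "d = 2 * g + 4"
  shows "type1 n d = {{j, j + 2} \<union> T | j T. 1 \<le> j \<and> j < n - d + 1 \<and> T \<in> pair_unions (Suc g) (j + 3) n}"
proof -
  have h: "d div 2 = 2 + g" and range: "2 \<le> k \<and> k \<le> d div 2 - 1 \<longleftrightarrow> 2 \<le> k \<and> k < 2 + g" for k
    using assms by auto
  have *: "T \<in> pair_unions (Suc g) (i + 3) n \<longleftrightarrow>
     (\<exists>j. j 1 = i \<and> j 1 + 3 \<le> j 2 \<and> (\<forall>k. 2 \<le> k \<and> k < 2 + g \<longrightarrow> j k + 2 \<le> j (k + 1)) \<and>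
        j (2 + g) < n \<and> T = (\<Union>k\<in>{2..2 + g}. {j k, j k + 1}))" for T i
  proof
    assume "T \<in> pair_unions (Suc g) (i + 3) n"
    then obtain j :: "nat \<Rightarrow> nat" where j: "i + 3 \<le> j 2"
        "\<forall>k. 2 \<le> k \<and> k < 2 + g \<longrightarrow> j k + 2 \<le> j (k + 1)" "j (2 + g) < n"
        and T: "T = (\<Union>k\<in>{2..2 + g}. {j k, j k + 1})"
      unfolding pair_unions_indexed[where l = 2] by blast
    have "T = (\<Union>k\<in>{2..2 + g}. {(j(1 := i)) k, (j(1 := i)) k + 1})" unfolding T by auto
    then show "\<exists>j. j 1 = i \<and> j 1 + 3 \<le> j 2 \<and> (\<forall>k. 2 \<le> k \<and> k < 2 + g \<longrightarrow> j k + 2 \<le> j (k + 1)) \<and>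
        j (2 + g) < n \<and> T = (\<Union>k\<in>{2..2 + g}. {j k, j k + 1})"
      using j by (intro exI[of _ "j(1 := i)"]) auto
  next
    assume "\<exists>j. j 1 = i \<and> j 1 + 3 \<le> j 2 \<and> (\<forall>k. 2 \<le> k \<and> k < 2 + g \<longrightarrow> j k + 2 \<le> j (k + 1)) \<and>
        j (2 + g) < n \<and> T = (\<Union>k\<in>{2..2 + g}. {j k, j k + 1})"
    then obtain j :: "nat \<Rightarrow> nat" where "j 1 = i" "j 1 + 3 \<le> j 2"
        "\<forall>k. 2 \<le> k \<and> k < 2 + g \<longrightarrow> j k + 2 \<le> j (k + 1)" "j (2 + g) < n"
        "T = (\<Union>k\<in>{2..2 + g}. {j k, j k + 1})" by blast
    then show "T \<in> pair_unions (Suc g) (i + 3) n"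
      unfolding pair_unions_indexed[where l = 2] by (intro exI[of _ j]) simp
  qed
  show ?thesis unfolding type1_def range unfolding * h by blast
qed

lemma type2a_eq:
  assumes d: "d = 2 * g + 4" and n: "d < n"
  shows "type2a n d = {{j, j + 1, j + 2} \<union> T \<union> {n} | j T.
     1 \<le> j \<and> j \<le> n - d + 1 \<and> T \<in> pair_unions g (j + 3) (n - 1)}"
proof -
  have h: "d div 2 - 1 = g + 1" and range: "2 \<le> k \<and> k \<le> d div 2 - 2 \<longleftrightarrow> 2 \<le> k \<and> k < g + 1" for k
    using d by auto
  have *: "i \<le> n - d + 1 \<and> T \<in> pair_unions g (i + 3) (n - 1) \<longleftrightarrow>
     (\<exists>j. j 1 = i \<and> j 1 \<le> n - d + 1 \<and> (6 \<le> d \<longrightarrow> j 1 + 3 \<le> j 2) \<and>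
        (\<forall>k. 2 \<le> k \<and> k < g + 1 \<longrightarrow> j k + 2 \<le> j (k + 1)) \<and>
        j (g + 1) < n - 1 \<and> T = (\<Union>k\<in>{2..g + 1}. {j k, j k + 1}))" for T i
  proof (cases g)
    case 0
    show ?thesis
    proof
      assume "i \<le> n - d + 1 \<and> T \<in> pair_unions g (i + 3) (n - 1)"
      then show "\<exists>j. j 1 = i \<and> j 1 \<le> n - d + 1 \<and> (6 \<le> d \<longrightarrow> j 1 + 3 \<le> j 2) \<and>
          (\<forall>k. 2 \<le> k \<and> k < g + 1 \<longrightarrow> j k + 2 \<le> j (k + 1)) \<and>
          j (g + 1) < n - 1 \<and> T = (\<Union>k\<in>{2..g + 1}. {j k, j k + 1})"
        using 0 d n by (intro exI[of _ "\<lambda>_. i"]) auto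
    qed (use 0 in auto)
  next
    case (Suc g')
    have u: "g + 1 = 2 + g'" and d6: "6 \<le> d" using Suc d by auto
    show ?thesis
      unfolding u
    proof
      assume L: "i \<le> n - d + 1 \<and> T \<in> pair_unions g (i + 3) (n - 1)"
      then obtain j :: "nat \<Rightarrow> nat" where j: "i + 3 \<le> j 2"
          "\<forall>k. 2 \<le> k \<and> k < 2 + g' \<longrightarrow> j k + 2 \<le> j (k + 1)" "j (2 + g') < n - 1"
          and T: "T = (\<Union>k\<in>{2..2 + g'}. {j k, j k + 1})"
        unfolding Suc pair_unions_indexed[where l = 2] by blast
      have "T = (\<Union>k\<in>{2..2 + g'}. {(j(1 := i)) k, (j(1 := i)) k + 1})" unfolding T by auto
      then show "\<exists>j. j 1 = i \<and> j 1 \<le> n - d + 1 \<and> (6 \<le> d \<longrightarrow> j 1 + 3 \<le> j 2) \<and>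
          (\<forall>k. 2 \<le> k \<and> k < 2 + g' \<longrightarrow> j k + 2 \<le> j (k + 1)) \<and>
          j (2 + g') < n - 1 \<and> T = (\<Union>k\<in>{2..2 + g'}. {j k, j k + 1})"
        using j L by (intro exI[of _ "j(1 := i)"]) auto
    next
      assume "\<exists>j. j 1 = i \<and> j 1 \<le> n - d + 1 \<and> (6 \<le> d \<longrightarrow> j 1 + 3 \<le> j 2) \<and>
          (\<forall>k. 2 \<le> k \<and> k < 2 + g' \<longrightarrow> j k + 2 \<le> j (k + 1)) \<and>
          j (2 + g') < n - 1 \<and> T = (\<Union>k\<in>{2..2 + g'}. {j k, j k + 1})"
      then obtain j :: "nat \<Rightarrow> nat" where j: "j 1 = i" "j 1 \<le> n - d + 1" "j 1 + 3 \<le> j 2"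
          "\<forall>k. 2 \<le> k \<and> k < 2 + g' \<longrightarrow> j k + 2 \<le> j (k + 1)" "j (2 + g') < n - 1"
          "T = (\<Union>k\<in>{2..2 + g'}. {j k, j k + 1})" using d6 by blast
      then have "T \<in> pair_unions g (i + 3) (n - 1)"
        unfolding Suc pair_unions_indexed[where l = 2] by (intro exI[of _ j]) simp
      then show "i \<le> n - d + 1 \<and> T \<in> pair_unions g (i + 3) (n - 1)" using j(1,2) by simp
    qed
  qed
  show ?thesis unfolding type2a_def range * h by blast
qed

lemma type2b_eq:
  assumes "d = 2 * g + 4"
  shows "type2b n d = {{1, 2} \<union> T | T. T \<in> pair_unions (Suc g) 3 n}"
proof -
  have h: "d div 2 - 1 = 1 + g" and range: "1 \<le> k \<and> k \<le> d div 2 - 2 \<longleftrightarrow> 1 \<le> k \<and> k < 1 + g" for k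
    using assms by auto
  show ?thesis unfolding type2b_def range h pair_unions_indexed[where l = 1] by blast
qed

lemma card_2_least:
  fixes S :: "nat set"
  assumes "finite S" "2 \<le> card S"
  obtains s r T where "S = {s, r} \<union> T" "s < r" "\<And>t. t \<in> T \<Longrightarrow> r < t" "card S = card T + 2"
proof -
  define s where "s = Min S"
  define r where "r = Min (S - {s})"
  have s: "s \<in> S" "\<And>x. x \<in> S \<Longrightarrow> s \<le> x" unfolding s_def using assms by (auto intro!: Min_in)
  have "card (S - {s}) \<noteq> 0" using s assms by simp
  then have "S - {s} \<noteq> {}" by force
  then have r: "r \<in> S - {s}" "\<And>x. x \<in> S - {s} \<Longrightarrow> r \<le> x"
    unfolding r_def using assms(1) Min_in[of "S - {s}"] by auto
  have "s < r" using s(2)[of r] r(1) by (auto simp: less_le)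
  moreover have "r < t" if "t \<in> S - {s, r}" for t using r(2)[of t] that by (auto simp: less_le)
  moreover have "S = {s, r} \<union> (S - {s, r})" using s r by auto
  moreover have "card S = card (S - {s, r}) + 2"
    using s(1) r(1) assms by (simp add: card_Diff_subset)
  ultimately show thesis by (intro that) auto
qed

text \<open>
  The three cases of \<open>one_sided_iff\<close> are types 1, 2b and 2a, in this order. The upper bounds on \<open>j 1\<close> say that
  there is room for the remaining labels.
\<close>

lemma types_eq_one_sided:
  assumes d: "d = 2 * g + 4" and n: "d < n"
  shows "type1 n d \<union> type2a n d \<union> type2b n d = {S. S \<subseteq> {1..n} \<and> card S = d \<and> one_sided n S}"
proof (intro equalityI subsetI)
  fix S assume "S \<in> type1 n d \<union> type2a n d \<union> type2b n d"
  then consider "S \<in> type1 n d" | "S \<in> type2a n d" | "S \<in> type2b n d" by blast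
  then have "\<exists>s r T. 1 \<le> s \<and> s < r \<and> T \<subseteq> {r + 1..n} \<and> card T = 2 * g + 2 \<and> S = {s, r} \<union> T \<and> r \<le> n \<and>
      (r = s + 2 \<and> T \<in> pair_unions (g + 1) (s + 3) n \<or>
       s = 1 \<and> r = 2 \<and> T \<in> pair_unions (g + 1) 3 n \<or>
       r = s + 1 \<and> s + 2 < n \<and> (\<exists>U\<in>pair_unions g (s + 3) (n - 1). T = {s + 2, n} \<union> U))"
  proof cases
    case 1
    then obtain j T where T: "S = {j, j + 2} \<union> T" "1 \<le> j" "j < n - d + 1" "T \<in> pair_unions (g + 1) (j + 3) n"
      unfolding type1_eq[OF d] Suc_eq_plus1 by blast
    have "j + 2 + 1 = j + 3" by simp
    then have T3: "T \<subseteq> {j + 2 + 1..n}" "card T = 2 * (g + 1)"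
      using pair_unionsD[OF T(4)] by (simp_all only:)
    have "j + 2 \<le> n" using T(3) d n by simp
    then show ?thesis
      by (intro exI[of _ j] exI[of _ "j + 2"] exI[of _ T]) (use T T3 in simp)
  next
    case 2
    then obtain j U where U: "S = {j, j + 1, j + 2} \<union> U \<union> {n}" "1 \<le> j" "j \<le> n - d + 1"
        "U \<in> pair_unions g (j + 3) (n - 1)"
      unfolding type2a_eq[OF d n] by blast
    note D = pair_unionsD[OF U(4)]
    have jn: "j + 2 < n" using U(3) d n by simp
    have notin: "j + 2 \<notin> U" "n \<notin> U" "finite U" using D jn finite_subset[of U] by auto
    have "card ({j + 2, n} \<union> U) = 2 * (g + 1)" using D notin jn by simp
    moreover have "{j + 2, n} \<union> U \<subseteq> {(j + 1) + 1..n}" using D jn by force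
    moreover have "S = {j, j + 1} \<union> ({j + 2, n} \<union> U)" using U(1) by auto
    ultimately show ?thesis
      using U(2,4) jn
      by (intro exI[of _ j] exI[of _ "j + 1"] exI[of _ "{j + 2, n} \<union> U"]) auto
  next
    case 3
    then obtain T where T: "S = {1, 2} \<union> T" "T \<in> pair_unions (g + 1) 3 n"
      unfolding type2b_eq[OF d] Suc_eq_plus1 by blast
    have T3: "T \<subseteq> {2 + 1..n}" "card T = 2 * (g + 1)" using pair_unionsD[OF T(2)] by auto
    show ?thesis
      by (rule exI[of _ 1], rule exI[of _ 2], rule exI[of _ T]) (use T T3 d n in \<open>simp\<close>)
  qed
  then obtain s r T where c: "1 \<le> s \<and> s < r \<and> T \<subseteq> {r + 1..n} \<and> card T = 2 * g + 2 \<and> S = {s, r} \<union> T \<and> r \<le> n \<and>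
      (r = s + 2 \<and> T \<in> pair_unions (g + 1) (s + 3) n \<or>
       s = 1 \<and> r = 2 \<and> T \<in> pair_unions (g + 1) 3 n \<or>
       r = s + 1 \<and> s + 2 < n \<and> (\<exists>U\<in>pair_unions g (s + 3) (n - 1). T = {s + 2, n} \<union> U))"
    by (elim exE)
  then have *: "1 \<le> s" "s < r" "T \<subseteq> {r + 1..n}" "card T = 2 * g + 2" "r \<le> n"
    and S: "S = {s, r} \<union> T" and cond:
      "r = s + 2 \<and> T \<in> pair_unions (g + 1) (s + 3) n \<or>
       s = 1 \<and> r = 2 \<and> T \<in> pair_unions (g + 1) 3 n \<or>
       r = s + 1 \<and> s + 2 < n \<and> (\<exists>U\<in>pair_unions g (s + 3) (n - 1). T = {s + 2, n} \<union> U)"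
    by blast+
  have "one_sided n S" unfolding S one_sided_iff[OF *(1-4)] by (rule cond)
  moreover have "S \<subseteq> {1..n}" using * by (auto simp: S)
  moreover have "card S = d"
  proof -
    have "finite T" "s \<notin> T" "r \<notin> T" using * finite_subset[of T] by auto
    then show ?thesis using *(2,4) d by (simp add: S)
  qed
  ultimately show "S \<in> {S. S \<subseteq> {1..n} \<and> card S = d \<and> one_sided n S}" by blast
next
  fix S assume "S \<in> {S. S \<subseteq> {1..n} \<and> card S = d \<and> one_sided n S}"
  then have S: "S \<subseteq> {1..n}" "card S = d" "one_sided n S" by auto
  have "finite S" using S(1) finite_subset by blast
  then obtain s r T where T: "S = {s, r} \<union> T" "s < r" "\<And>t. t \<in> T \<Longrightarrow> r < t" "card S = card T + 2"
    by (rule card_2_least) (use S(2) d in auto)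
  have s: "1 \<le> s" using S(1) T(1) by auto
  have Tr: "T \<subseteq> {r + 1..n}"
  proof
    fix t assume "t \<in> T"
    then show "t \<in> {r + 1..n}" using T(3)[of t] S(1) T(1) by auto
  qed
  have cT: "card T = 2 * g + 2" using T(4) S(2) d by simp
  have "card T \<le> card {r + 1..n}" using Tr by (intro card_mono) auto
  then have room: "r + d \<le> n + 2" "r < n" using cT d by auto
  from S(3)[unfolded T(1) one_sided_iff[OF s T(2) Tr cT]] show "S \<in> type1 n d \<union> type2a n d \<union> type2b n d"
  proof (elim disjE conjE bexE)
    assume "r = s + 2" "T \<in> pair_unions (g + 1) (s + 3) n"
    then have "S \<in> type1 n d" unfolding type1_eq[OF d] Suc_eq_plus1
      using T(1) s room n by (intro CollectI exI[of _ s] exI[of _ T]) auto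
    then show ?thesis by blast
  next
    assume "s = 1" "r = 2" "T \<in> pair_unions (g + 1) 3 n"
    then have "S \<in> type2b n d" unfolding type2b_eq[OF d] Suc_eq_plus1 using T(1) by blast
    then show ?thesis by blast
  next
    fix U assume U: "r = s + 1" "s + 2 < n" "U \<in> pair_unions g (s + 3) (n - 1)" "T = {s + 2, n} \<union> U"
    have "S = {s, s + 1, s + 2} \<union> U \<union> {n}" using U(1,4) T(1) by auto
    then have "S \<in> type2a n d" unfolding type2a_eq[OF d n]
      using U(3) s room(1) U(1) n by (intro CollectI exI[of _ s] exI[of _ U]) auto
    then show ?thesis by blast
  qed
qed

text \<open>
  If \<open>I\<close> meets \<open>{1, 2}\<close> or has fewer than \<open>d div 2\<close> elements, \<open>{1, 2}\<close> and
  \<open>d div 2 - 1\<close> pairs cover it (type 2b). Otherwise let \<open>{i - 2, i}\<close>, where \<open>i\<close> is the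
  least element of \<open>I\<close>, take care of \<open>i\<close> and let the pairs cover the others (type 1). If these
  pairs have no room beyond \<open>i\<close>, then \<open>I\<close> lies in the last \<open>d\<close> labels, which form a set of
  type 2a.
\<close>

lemma types_cover:
  assumes d: "d = 2 * g + 4" and n: "d < n" and I: "I \<subseteq> {1..n}" "card I \<le> d div 2"
  shows "\<exists>S\<in>type1 n d \<union> type2a n d \<union> type2b n d. I \<subseteq> S"
proof -
  have fin: "finite I" using I(1) finite_subset by blast
  have cI: "card I \<le> g + 2" using I(2) d by simp
  show ?thesis
  proof (cases "card (I - {1, 2}) \<le> g + 1")
    case True
    have "I - {1, 2} \<subseteq> {3..n}"
    proof
      fix x assume "x \<in> I - {1, 2}"
      then have "x \<noteq> 1" "x \<noteq> 2" "1 \<le> x" "x \<le> n" using I(1) by auto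
      then show "x \<in> {3..n}" by simp
    qed
    moreover have "2 * (g + 1) \<le> Suc n - 3" using d n by simp
    ultimately obtain T where "T \<in> pair_unions (g + 1) 3 n" "I - {1, 2} \<subseteq> T"
      using pair_unions_cover[OF _ True] by blast
    then have "{1, 2} \<union> T \<in> type2b n d" "I \<subseteq> {1, 2} \<union> T" unfolding type2b_eq[OF d] Suc_eq_plus1 by auto
    then show ?thesis by blast
  next
    case False
    have "card (I - {1, 2}) \<le> card I" using fin by (intro card_mono) auto
    then have "card (I - {1, 2}) = card I" using False cI by simp
    then have "I - {1, 2} = I" using fin by (intro card_subset_eq) auto
    then have no12: "1 \<notin> I" "2 \<notin> I" by auto
    have ne: "I \<noteq> {}" using False by auto
    define i where "i = Min I"
    have i: "i \<in> I" "\<And>x. x \<in> I \<Longrightarrow> i \<le> x" unfolding i_def using fin ne by auto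
    have "1 \<le> i" "i \<noteq> 1" "i \<noteq> 2" using i(1) I(1) no12 by auto
    then have i3: "3 \<le> i" by simp
    show ?thesis
    proof (cases "i + d \<le> n + 2")
      case True
      have sub: "I - {i} \<subseteq> {(i - 2) + 3..n}"
      proof
        fix x assume "x \<in> I - {i}"
        then have "i \<le> x" "x \<noteq> i" "x \<le> n" using i(2) I(1) by auto
        then show "x \<in> {(i - 2) + 3..n}" using i3 by simp
      qed
      have "card (I - {i}) \<le> g + 1" "2 * (g + 1) \<le> Suc n - ((i - 2) + 3)"
        using cI i(1) fin True d i3 by auto
      from pair_unions_cover[OF sub this] obtain T where
        T: "T \<in> pair_unions (g + 1) ((i - 2) + 3) n" "I - {i} \<subseteq> T" by blast
      have "1 \<le> i - 2" "i - 2 < n - d + 1" using i3 True by auto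
      then have "{i - 2, i - 2 + 2} \<union> T \<in> type1 n d"
        unfolding type1_eq[OF d] Suc_eq_plus1 using T(1)
        by (intro CollectI exI[of _ "i - 2"] exI[of _ T]) simp
      moreover have "I \<subseteq> {i - 2, i - 2 + 2} \<union> T" using T(2) i3 by auto
      ultimately show ?thesis by blast
    next
      case False
      let ?j = "n - d + 1" and ?U = "{n - d + 1 + 3..n - 1}"
      have "?U \<in> pair_unions g (?j + 3) (n - 1)"
        by (rule pair_unionsI) (use d n in auto)
      then have "{?j, ?j + 1, ?j + 2} \<union> ?U \<union> {n} \<in> type2a n d"
        unfolding type2a_eq[OF d n] by (intro CollectI exI[of _ ?j] exI[of _ ?U]) simp
      moreover have "I \<subseteq> {?j, ?j + 1, ?j + 2} \<union> ?U \<union> {n}"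
      proof
        fix x assume "x \<in> I"
        then have "i \<le> x" "x \<le> n" using i(2) I(1) by auto
        then show "x \<in> {?j, ?j + 1, ?j + 2} \<union> ?U \<union> {n}" using False d n by auto
      qed
      ultimately show ?thesis by blast
    qed
  qed
qed

section \<open>The polytope\<close>

context centred_general_configuration
begin

text \<open>
  A functional that vanishes on \<open>S\<close> is unique up to a factor, so the signs of one of them decide
  whether some other one is positive off \<open>S\<close>.
\<close>

lemma cofacet_iff_constant_sign:
  assumes S: "S \<subseteq> {1..n}" "card S = DIM('a)"
    and zero: "\<And>i. i \<in> S \<Longrightarrow> \<alpha> + a \<bullet> q i = 0"
    and sign: "\<And>x. x \<in> {1..n} - S \<Longrightarrow> 0 < (\<alpha> + a \<bullet> q x) * \<epsilon> x"
    and unit: "\<And>x. \<epsilon> x * \<epsilon> x = (1::real)"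
  shows "cofacet S \<longleftrightarrow> (\<forall>x\<in>{1..n} - S. \<forall>y\<in>{1..n} - S. \<epsilon> x = \<epsilon> y)"
proof
  assume "cofacet S"
  then obtain \<beta> b where g: "\<forall>i\<in>S. \<beta> + b \<bullet> q i = 0" "\<forall>i\<in>{1..n} - S. 0 < \<beta> + b \<bullet> q i"
    unfolding cofacet_def by blast
  show "\<forall>x\<in>{1..n} - S. \<forall>y\<in>{1..n} - S. \<epsilon> x = \<epsilon> y"
  proof (intro ballI)
    fix x y assume xy: "x \<in> {1..n} - S" "y \<in> {1..n} - S"
    have "\<beta> \<noteq> 0 \<or> b \<noteq> 0" using g(2) xy(1) by force
    then obtain c where c: "\<alpha> = c * \<beta>" "a = c *\<^sub>R b"
      using functional_proportional[OF S zero g(1)[rule_format]] by blast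
    have "0 < c * \<epsilon> z" if "z \<in> {1..n} - S" for z
    proof -
      have "(\<alpha> + a \<bullet> q z) * \<epsilon> z = (\<beta> + b \<bullet> q z) * (c * \<epsilon> z)"
        unfolding c by (simp add: algebra_simps)
      with sign[OF that] have "0 < (\<beta> + b \<bullet> q z) * (c * \<epsilon> z)" by simp
      then show ?thesis by (rule zero_less_mult_pos) (use g(2) that in blast)
    qed
    from this[OF xy(1)] this[OF xy(2)] have "0 < (c * \<epsilon> x) * (c * \<epsilon> y)" by (rule mult_pos_pos)
    then have "0 < c\<^sup>2 * (\<epsilon> x * \<epsilon> y)" by (simp add: power2_eq_square algebra_simps)
    then have pos: "0 < \<epsilon> x * \<epsilon> y" by (simp add: zero_less_mult_iff)
    have "\<epsilon> x = 1 \<or> \<epsilon> x = - 1" "\<epsilon> y = 1 \<or> \<epsilon> y = - 1"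
      using unit[of x] unit[of y] by (auto simp: square_eq_1_iff)
    with pos show "\<epsilon> x = \<epsilon> y" by auto
  qed
next
  assume const: "\<forall>x\<in>{1..n} - S. \<forall>y\<in>{1..n} - S. \<epsilon> x = \<epsilon> y"
  show "cofacet S"
  proof (cases "{1..n} - S = {}")
    case True
    then show ?thesis unfolding cofacet_def using S zero by blast
  next
    case False
    then obtain w where w: "w \<in> {1..n} - S" by blast
    have "0 < \<epsilon> w * \<alpha> + (\<epsilon> w *\<^sub>R a) \<bullet> q x" if x: "x \<in> {1..n} - S" for x
    proof -
      have "\<epsilon> x = \<epsilon> w" using const x w by blast
      then show ?thesis using sign[OF x] by (simp add: algebra_simps)
    qed
    moreover have "\<epsilon> w * \<alpha> + (\<epsilon> w *\<^sub>R a) \<bullet> q i = 0" if "i \<in> S" for i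
      using zero[OF that] by (simp flip: distrib_left)
    ultimately show ?thesis unfolding cofacet_def using S by blast
  qed
qed

end

lemma position_sign_mult_self: "position_sign S x * position_sign S x = 1"
proof -
  have unit: "(-1) ^ k * (-1) ^ k = (1 :: real)" for k :: nat by (simp flip: power_add)
  have "lex_sign alternating_second A * lex_sign alternating_second A = 1" for A
    by (rule lex_sign_mult_self) (simp add: alternating_second_def unit)
  then show ?thesis
    unfolding position_sign_def by (simp only: mult.left_commute mult.assoc unit mult_1_right)
qed

text \<open>
  Row 0 of the matrix is constantly 1 and serves as the homogenizing coordinate; the other \<open>d\<close>
  rows are the coordinates of the points. Translating the points only changes the constant terms of
  the affine functionals.
\<close>

lemma centred_points_with_position_signs:
  assumes d: "CARD('n::finite) = d" and n: "0 < n"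
  shows "\<exists>q :: nat \<Rightarrow> real ^ 'n. (\<Sum>i\<in>{1..n}. q i) = 0 \<and>
    (\<forall>S. S \<subseteq> {1..n} \<and> card S = d \<longrightarrow> (\<exists>\<alpha> a. (\<forall>i\<in>S. \<alpha> + a \<bullet> q i = 0) \<and>
           (\<forall>x\<in>{1..n} - S. 0 < (\<alpha> + a \<bullet> q x) * position_sign S x)))"
proof -
  have "alternating_second k i * alternating_second k i = 1" for k i
    by (simp add: alternating_second_def flip: power_add)
  then obtain t where t: "realizes_lex_signs alternating_second t n"
    using lex_signs_realizable by blast
  have "finite (UNIV :: 'n set)" "finite {1..d}" "card (UNIV :: 'n set) = card {1..d}"
    using d by auto
  then obtain idx :: "'n \<Rightarrow> nat" where idx: "bij_betw idx UNIV {1..d}"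
    using finite_same_card_bij by blast
  define p :: "nat \<Rightarrow> real ^ 'n" where
    "p i = (\<chi> k. alternating_second (idx k) i * t i ^ idx k)" for i
  define c where "c = (\<Sum>i\<in>{1..n}. p i) /\<^sub>R n"
  have val: "(y 0 + (\<chi> k. y (idx k)) \<bullet> c) + (\<chi> k. y (idx k)) \<bullet> (p i - c)
      = signed_poly alternating_second t d y i" for y i
  proof -
    have "(\<chi> k. y (idx k)) \<bullet> p i = (\<Sum>k\<in>UNIV. y (idx k) * alternating_second (idx k) i * t i ^ idx k)"
      by (simp add: inner_vec_def p_def mult.assoc)
    also have "\<dots> = (\<Sum>j\<in>{1..d}. y j * alternating_second j i * t i ^ j)"
      by (rule sum.reindex_bij_betw[OF idx])
    finally have "(\<chi> k. y (idx k)) \<bullet> p i = (\<Sum>j\<in>{1..d}. y j * alternating_second j i * t i ^ j)" .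
    moreover have "{..d} = insert 0 {1..d}" by auto
    ultimately show ?thesis
      by (simp add: signed_poly_def inner_diff_right alternating_second_def)
  qed
  show ?thesis
  proof (intro exI[of _ "\<lambda>i. p i - c"] conjI allI impI)
    show "(\<Sum>i\<in>{1..n}. p i - c) = 0"
    proof -
      have "(\<Sum>i\<in>{1..n}. c) = real n *\<^sub>R c" by (simp only: sum_constant_scaleR card_atLeastAtMost) simp
      also have "\<dots> = (\<Sum>i\<in>{1..n}. p i)" unfolding c_def using n by simp
      finally show ?thesis by (simp only: sum_subtractf diff_self)
    qed
    fix S assume "S \<subseteq> {1..n} \<and> card S = d"
    then have S: "S \<subseteq> {1..n}" "card S = d" by auto
    obtain y where "\<And>i. i \<in> S \<Longrightarrow> signed_poly alternating_second t d y i = 0"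
      and "\<And>x. x \<in> {1..n} - S \<Longrightarrow> 0 < signed_poly alternating_second t d y x *
            (-1) ^ card {s \<in> S. x < s} * lex_sign alternating_second (insert x S)"
      by (rule realizes_lex_signsE[OF t S(1), unfolded S(2)]) (rule that; blast)
    then show "\<exists>\<alpha> a. (\<forall>i\<in>S. \<alpha> + a \<bullet> (p i - c) = 0) \<and>
        (\<forall>x\<in>{1..n} - S. 0 < (\<alpha> + a \<bullet> (p x - c)) * position_sign S x)"
      by (intro exI[of _ "y 0 + (\<chi> k. y (idx k)) \<bullet> c"] exI[of _ "\<chi> k. y (idx k)"])
         (simp add: val position_sign_def mult.assoc)
  qed
qed

theorem theorem2p1:
  fixes m d n :: nat
  assumes "d \<ge> 4" and "even d" and "n = m + d + 1"
    and "CARD('n::finite) = d"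
  shows "\<exists>(P :: (real ^ 'n) set) (F :: nat \<Rightarrow> (real ^ 'n) set).
           simple_polytope d P \<and> polar_to_neighborly d P \<and>
           bij_betw F {1..n} {G. G facet_of P} \<and>
           bij_betw (facet_labels n F) {v. v extreme_point_of P}
             (type1 n d \<union> type2a n d \<union> type2b n d)"
proof -
  let ?V = "type1 n d \<union> type2a n d \<union> type2b n d"
  define g where "g = d div 2 - 2"
  have d: "d = 2 * g + 4" using assms(1,2) by (auto simp: g_def elim!: evenE)
  have dn: "d < n" "0 < n" using assms(3) by auto
  have dim: "DIM(real ^ 'n) = d" using assms(4) by simp
  obtain q :: "nat \<Rightarrow> real ^ 'n" where centred: "(\<Sum>i\<in>{1..n}. q i) = 0"
    and signs: "\<forall>S. S \<subseteq> {1..n} \<and> card S = d \<longrightarrow> (\<exists>\<alpha> a. (\<forall>i\<in>S. \<alpha> + a \<bullet> q i = 0) \<and>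
           (\<forall>x\<in>{1..n} - S. 0 < (\<alpha> + a \<bullet> q x) * position_sign S x))"
    using centred_points_with_position_signs[OF assms(4) dn(2)] by blast
  interpret C: centred_general_configuration q n
  proof
    fix S assume "S \<subseteq> {1..n}" "card S = DIM(real ^ 'n)"
    then obtain \<alpha> a where f: "\<forall>i\<in>S. \<alpha> + a \<bullet> q i = 0"
        "\<forall>x\<in>{1..n} - S. 0 < (\<alpha> + a \<bullet> q x) * position_sign S x"
      using signs dim by metis
    then have "\<alpha> + a \<bullet> q x \<noteq> 0" if "x \<in> {1..n} - S" for x using that by force
    with f(1) show "\<exists>\<alpha> a. (\<forall>i\<in>S. \<alpha> + a \<bullet> q i = 0) \<and> (\<forall>i\<in>{1..n} - S. \<alpha> + a \<bullet> q i \<noteq> 0)"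
      by blast
  qed (use centred dn dim in auto)
  have cofacet: "C.cofacet S \<longleftrightarrow> S \<in> ?V" for S
  proof (cases "S \<subseteq> {1..n} \<and> card S = d")
    case True
    then obtain \<alpha> a where f: "\<forall>i\<in>S. \<alpha> + a \<bullet> q i = 0"
        "\<forall>x\<in>{1..n} - S. 0 < (\<alpha> + a \<bullet> q x) * position_sign S x"
      using signs by metis
    have "C.cofacet S \<longleftrightarrow> one_sided n S"
      unfolding one_sided_def
      by (rule C.cofacet_iff_constant_sign[of _ \<alpha> a]) (use True f dim position_sign_mult_self in auto)
    then show ?thesis unfolding types_eq_one_sided[OF d dn(1)] using True by simp
  next
    case False
    then show ?thesis unfolding types_eq_one_sided[OF d dn(1)] C.cofacet_def dim by blast
  qed
  have cover: "\<exists>S. C.cofacet S \<and> I \<subseteq> S" if "I \<subseteq> {1..n}" "card I \<le> d div 2" for I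
    using types_cover[OF d dn(1) that] cofacet by blast
  interpret P: covered_general_configuration q n
  proof
    fix i assume "i \<in> {1..n}"
    then show "\<exists>S. C.cofacet S \<and> i \<in> S" using cover[of "{i}"] assms(1) by auto
  qed
  have "simple_polytope d C.dual" using P.simple_polytope_dual unfolding dim .
  moreover have "polar_to_neighborly d C.dual"
    by (rule P.polar_to_neighborly_dual[unfolded dim]) (rule cover)
  moreover have "bij_betw C.side {1..n} {G. G facet_of C.dual}" by (rule P.bij_betw_side)
  moreover have "{S. C.cofacet S} = ?V" using cofacet by blast
  then have "bij_betw (facet_labels n C.side) {v. v extreme_point_of C.dual} ?V"
    using P.bij_betw_facet_labels by simp
  ultimately show ?thesis by blast
qed

end
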